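(* Every separable Banach space satisfying the Cantorized-Enflo criterion is ergodic.
   Context: Ergodic: for a separable Banach space $X$, $\mathcal{SB}(X)$ is the set of infinite-dimensional closed linear subspaces of $X$, equipped with the (relative) Effros Borel structure, i.e. the $\sigma$-algebra generated by the sets $\{F: F\cap U\neq\emptyset\}$, $U\subseteq X$ open. $E_0$ is the equivalence relation on $2^{\mathbb N}$ given by $xE_0y$ iff there is $N$ with $x(n)=y(n)$ for all $n\ge N$. A separable Banach space $X$ is ergodic if there is a Borel map $\phi:2^{\mathbb N}\to\mathcal{SB}(X)$ such that for all $x,y$: $xE_0y$ iff $\phi(x)$ is (linearly) isomorphic to $\phi(y)$. Cantorized-Enflo criterion: $\mathbb N=\{1,2,\dots\}$, and for $n\in\mathbb N$ let $I_n=\{2^n,2^n+1,\dots,2^{n+1}-1\}$. Given sequences $(z_{j,\epsilon})_{j\in\mathbb N}$ in $X$ and $(z^*_{j,\epsilon})_{j\in\mathbb N}$ in $X^*$ ($\epsilon=0,1$), put $Z=\overline{\mathrm{span}}\{z_{j,\epsilon}: j\in\mathbb N,\ \epsilon=0,1\}$ and, for $t\in2^{\mathbb N}$, $X_t=\overline{\mathrm{span}}\{z_{j,t(n)}: j\in I_n,\ n=1,2,3,\dots\}$. For a bounded linear operator $T:X_t\to Z$ put $\beta^n_t(T)=2^{-n}\sum_{j\in I_n}z^*_{j,t(n)}(T(z_{j,t(n)}))$. The Banach space $X$ satisfies the Cantorized-Enflo criterion if there exist bounded sequences $(z_{j,\epsilon})_{j}$ in $X$ and $(z^*_{j,\epsilon})_{j}$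 in $X^*$ ($\epsilon=0,1$) and a sequence of real scalars $(\alpha_n)_n$ such that: (1) $z^*_{i,\epsilon}(z_{j,\tau})=\delta_{ij}\delta_{\epsilon\tau}$ for all $i,j\in\mathbb N$ and $\epsilon,\tau\in\{0,1\}$; (2) for all $t,s\in2^{\mathbb N}$, every bounded linear operator $T:X_t\to X_s$ and every $n\ge2$, $|\beta^n_t(T)-\beta^{n-1}_t(T)|\le\alpha_n\|T\|$; (3) $\sum_n\alpha_n<\infty$. *)

theory Defs
  imports "HOL-Analysis.Analysis"
begin

definition E0 :: "(nat \<Rightarrow> bool) \<Rightarrow> (nat \<Rightarrow> bool) \<Rightarrow> bool" where
  "E0 x y \<longleftrightarrow> (\<exists>N. \<forall>n\<ge>N. x n = y n)"

definition effros :: "'a::topological_space set measure" where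
  "effros = sigma {F. closed F} {{F. closed F \<and> F \<inter> U \<noteq> {}} |U. open U}"

definition SB :: "'a::real_normed_vector set set" where
  "SB = {F. closed F \<and> subspace F \<and> \<not> (\<exists>B. finite B \<and> F = span B)}"

text \<open>An operator from a subspace \<open>F\<close> to a subspace \<open>G\<close> is represented by a function on the
  whole type; its values outside \<open>F\<close> are arbitrary and are never used.\<close>

definition bounded_linear_on ::
    "'a::real_normed_vector set \<Rightarrow> 'b::real_normed_vector set \<Rightarrow> ('a \<Rightarrow> 'b) \<Rightarrow> bool" where
  "bounded_linear_on F G T \<longleftrightarrow>
     T ` F \<subseteq> G \<and>
     (\<forall>x\<in>F. \<forall>y\<in>F. T (x + y) = T x + T y) \<and>
     (\<forall>c. \<forall>x\<in>F. T (c *\<^sub>R x) = c *\<^sub>R T x) \<and>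
     (\<exists>K. \<forall>x\<in>F. norm (T x) \<le> norm x * K)"

text \<open>Same shape as \<^term>\<open>onorm\<close>, with the supremum taken over \<open>F\<close>; the term at \<open>0\<close> is \<open>0 / 0 = 0\<close>.\<close>

definition onorm_on :: "'a::real_normed_vector set \<Rightarrow> ('a \<Rightarrow> 'b::real_normed_vector) \<Rightarrow> real" where
  "onorm_on F T = (SUP x\<in>F. norm (T x) / norm x)"

definition isomorphic_subspaces ::
    "'a::real_normed_vector set \<Rightarrow> 'b::real_normed_vector set \<Rightarrow> bool" where
  "isomorphic_subspaces F G \<longleftrightarrow>
     (\<exists>T S. bounded_linear_on F G T \<and> bounded_linear_on G F S \<and>
        (\<forall>x\<in>F. S (T x) = x) \<and> (\<forall>y\<in>G. T (S y) = y))"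

definition ergodic :: "'a::banach itself \<Rightarrow> bool" where
  "ergodic _ \<longleftrightarrow>
     (\<exists>\<phi> :: (nat \<Rightarrow> bool) \<Rightarrow> 'a set.
        \<phi> \<in> borel \<rightarrow>\<^sub>M restrict_space effros SB \<and>
        (\<forall>x y. E0 x y \<longleftrightarrow> isomorphic_subspaces (\<phi> x) (\<phi> y)))"

text \<open>Throughout, \<open>False\<close> and \<open>True\<close> encode the bits \<open>0\<close> and \<open>1\<close>. The criterion is indexed by the
  positive integers, hence the bounds \<open>j \<ge> 1\<close> and \<open>n \<ge> 1\<close>; the value \<open>t 0\<close> of
  \<open>t :: nat \<Rightarrow> bool\<close> is irrelevant.\<close>

definition dyadic_block :: "nat \<Rightarrow> nat set" where
  "dyadic_block n = {2 ^ n ..< 2 ^ (n + 1)}"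

definition branch_space ::
    "(nat \<Rightarrow> bool \<Rightarrow> 'a::real_normed_vector) \<Rightarrow> (nat \<Rightarrow> bool) \<Rightarrow> 'a set" where
  "branch_space z t = closure (span {z j (t n) |j n. n \<ge> 1 \<and> j \<in> dyadic_block n})"

definition block_trace ::
    "(nat \<Rightarrow> bool \<Rightarrow> 'a::real_normed_vector) \<Rightarrow> (nat \<Rightarrow> bool \<Rightarrow> 'a \<Rightarrow>\<^sub>L real) \<Rightarrow>
     nat \<Rightarrow> (nat \<Rightarrow> bool) \<Rightarrow> ('a \<Rightarrow> 'a) \<Rightarrow> real" where
  "block_trace z z' n t T =
     (\<Sum>j\<in>dyadic_block n. blinfun_apply (z' j (t n)) (T (z j (t n)))) / 2 ^ n"

definition cantorized_Enflo :: "'a::banach itself \<Rightarrow> bool" where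
  "cantorized_Enflo _ \<longleftrightarrow>
     (\<exists>(z :: nat \<Rightarrow> bool \<Rightarrow> 'a) (z' :: nat \<Rightarrow> bool \<Rightarrow> 'a \<Rightarrow>\<^sub>L real) (\<alpha> :: nat \<Rightarrow> real).
        (\<forall>\<epsilon>. bounded ((\<lambda>j. z j \<epsilon>) ` {1..}) \<and> bounded ((\<lambda>j. z' j \<epsilon>) ` {1..})) \<and>
        (\<forall>i\<ge>1. \<forall>j\<ge>1. \<forall>\<epsilon> \<tau>.
           blinfun_apply (z' i \<epsilon>) (z j \<tau>) = (if i = j \<and> \<epsilon> = \<tau> then 1 else 0)) \<and>
        (\<forall>t s T n. bounded_linear_on (branch_space z t) (branch_space z s) T \<and> n \<ge> 2 \<longrightarrow>
           \<bar>block_trace z z' n t T - block_trace z z' (n - 1) t T\<bar>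
             \<le> \<alpha> n * onorm_on (branch_space z t) T) \<and>
        summable \<alpha>)"

end

theory Submission
  imports Defs
begin

text \<open>Fix \<open>s\<close> and suppose that \<open>T : X_t \<rightarrow> X_s\<close> and \<open>T' : X_{t'} \<rightarrow> X_s\<close> are isomorphisms with constant \<open>K\<close> that
  nearly agree on the finitely many generators of a large block \<open>n\<close>, where \<open>t n = t' n\<close>. Then the block
  traces of \<open>T\<inverse> T'\<close> are close to 1 at \<open>n\<close>, vary little beyond \<open>n\<close>, and vanish wherever \<open>t\<close> and \<open>t'\<close> differ;
  hence \<open>t\<close> and \<open>t'\<close> are eventually equal. So isomorphism of the \<open>X_t\<close> is a countable union of relations whose
  sections lie, up to fixing one bit, in a single \<open>E_0\<close>-class. Each of them is obtained by Souslin's operation, since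
  a lower limit of graphs of \<open>K\<close>-isomorphisms is again such a graph once the images of the generators
  converge; therefore, if it were nonmeager, it would be comeager in an open box and some section would
  contain two inequivalent points. Thus isomorphism is meager. It contains \<open>E_0\<close>, because changing finitely
  many bits is a finite-rank perturbation, and a meager relation can be avoided by a continuous map
  \<open>f\<close> that preserves \<open>E_0\<close>; \<open>x \<mapsto> X_{f x}\<close> is the required reduction.\<close>

section \<open>Meager sets and Souslin's operation\<close>

text \<open>Through this instance \<open>nat \<Rightarrow> bool\<close> and its square are second
  countable, as the category arguments below require.\<close>

instance bool :: second_countable_topology
proof
  show "\<exists>B::bool set set. countable B \<and> open = generate_topology B"
  proof (intro exI[of _ UNIV] conjI ext iffI)
    show "generate_topology UNIV S" for S :: "bool set"
      by (rule generate_topology.Basis) simp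
  qed (auto simp: open_discrete countable_finite)
qed

definition meager :: "'a::topological_space set \<Rightarrow> bool" where
  "meager S \<longleftrightarrow> (\<exists>F::nat \<Rightarrow> 'a set. (\<forall>n. closed (F n) \<and> interior (F n) = {}) \<and> S \<subseteq> (\<Union>n. F n))"

lemma meager_subset: "meager S \<Longrightarrow> R \<subseteq> S \<Longrightarrow> meager R"
  unfolding meager_def by blast

lemma meager_closed: "closed S \<Longrightarrow> interior S = {} \<Longrightarrow> meager S"
  unfolding meager_def by (rule exI[of _ "\<lambda>_. S"]) auto

lemma meager_countable_Union:
  fixes S :: "'b \<Rightarrow> 'a::topological_space set"
  assumes "countable I" "\<And>i. i \<in> I \<Longrightarrow> meager (S i)"
  shows "meager (\<Union>i\<in>I. S i)"
proof (cases "I = {}")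
  case True
  then show ?thesis by (simp add: meager_closed)
next
  case False
  have "\<forall>i\<in>I. \<exists>F::nat \<Rightarrow> 'a set. (\<forall>n. closed (F n) \<and> interior (F n) = {}) \<and> S i \<subseteq> (\<Union>n. F n)"
    using assms(2) unfolding meager_def by blast
  then obtain F :: "'b \<Rightarrow> nat \<Rightarrow> 'a set"
    where F: "\<And>i n. i \<in> I \<Longrightarrow> closed (F i n) \<and> interior (F i n) = {}"
      "\<And>i. i \<in> I \<Longrightarrow> S i \<subseteq> (\<Union>n. F i n)"
    unfolding bchoice_iff by blast
  define H where "H k = F (from_nat_into I (fst (prod_decode k))) (snd (prod_decode k))" for k
  have "(\<Union>i\<in>I. S i) \<subseteq> (\<Union>k. H k)"
  proof
    fix x assume "x \<in> (\<Union>i\<in>I. S i)"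
    then obtain i n where i: "i \<in> I" "x \<in> F i n" using F(2) by blast
    then have "x \<in> H (prod_encode (to_nat_on I i, n))"
      using assms(1) by (simp add: H_def)
    then show "x \<in> (\<Union>k. H k)" by blast
  qed
  moreover have "\<forall>k. closed (H k) \<and> interior (H k) = {}"
    using F(1) from_nat_into[OF False] by (simp add: H_def)
  ultimately show ?thesis unfolding meager_def by blast
qed

lemma meager_Un: "meager S \<Longrightarrow> meager R \<Longrightarrow> meager (S \<union> R)"
  using meager_countable_Union[of "UNIV::bool set" "\<lambda>b. if b then S else R"]
  by (simp add: UNIV_bool Un_commute)

text \<open>An open subset of \<open>closure G - G\<close> misses \<open>G\<close>, hence misses
  \<open>closure G\<close>, and is therefore empty.\<close>

lemma meager_frontier_open: "open G \<Longrightarrow> meager (closure G - G)"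
proof (rule meager_closed)
  assume G: "open G"
  then show "closed (closure G - G)" by (simp add: closed_Diff)
  have "interior (closure G - G) \<inter> closure G = {}"
    using interior_subset[of "closure G - G"] open_Int_closure_eq_empty[of "interior (closure G - G)" G] by blast
  then show "interior (closure G - G) = {}" using interior_subset[of "closure G - G"] by blast
qed

lemma meager_frontier_closed: "closed C \<Longrightarrow> meager (C - interior C)"
  using meager_frontier_open[of "- C"] by (simp add: closure_complement Diff_eq Int_commute open_Compl)

text \<open>The points at which \<open>A\<close> is of second category. In a second countable space
  \<open>A\<close> lies, up to a meager set, in the interior of this closed set, which thus acts as
  an open hull of \<open>A\<close>.\<close>

definition nonmeager_points :: "'a::topological_space set \<Rightarrow> 'a set" where
  "nonmeager_points A = {x. \<forall>U. open U \<longrightarrow> x \<in> U \<longrightarrow> \<not> meager (U \<inter> A)}"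

lemma closed_nonmeager_points: "closed (nonmeager_points A)"
proof -
  have "- nonmeager_points A = \<Union>{U. open U \<and> meager (U \<inter> A)}"
    unfolding nonmeager_points_def by blast
  then show ?thesis unfolding closed_def by auto
qed

text \<open>Countably many basic open sets in which \<open>A\<close> is meager cover all points of
  \<open>A\<close> that have such a neighbourhood.\<close>

lemma meager_Diff_nonmeager_points:
  fixes A :: "'a::second_countable_topology set"
  shows "meager (A - nonmeager_points A)"
proof -
  obtain B :: "'a set set" where B: "countable B" "topological_basis B"
    using ex_countable_basis by blast
  let ?I = "{U \<in> B. meager (U \<inter> A)}"
  have "A - nonmeager_points A \<subseteq> (\<Union>U\<in>?I. U \<inter> A)"
  proof
    fix x assume "x \<in> A - nonmeager_points A"
    then obtain U where U: "x \<in> A" "open U" "x \<in> U" "meager (U \<inter> A)"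
      unfolding nonmeager_points_def by blast
    obtain W where "W \<in> B" "x \<in> W" "W \<subseteq> U"
      using topological_basisE[OF B(2) U(2,3)] by blast
    then show "x \<in> (\<Union>U\<in>?I. U \<inter> A)"
      using U meager_subset[OF U(4), of "W \<inter> A"] by blast
  qed
  moreover have "meager (\<Union>U\<in>?I. U \<inter> A)"
    using B(1) by (intro meager_countable_Union) auto
  ultimately show ?thesis by (rule meager_subset[rotated])
qed

lemma nonmeager_points_subset_closure:
  fixes A :: "'a::topological_space set"
  shows "nonmeager_points A \<subseteq> closure A"
proof
  fix x assume x: "x \<in> nonmeager_points A"
  show "x \<in> closure A"
  proof (rule ccontr)
    assume "x \<notin> closure A"
    then have "\<not> meager ((- closure A) \<inter> A)"
      using x unfolding nonmeager_points_def by (simp add: open_Compl)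
    moreover have "(- closure A) \<inter> A = {}" using closure_subset by blast
    moreover have "meager ({} :: 'a set)" by (intro meager_closed) auto
    ultimately show False by simp
  qed
qed

text \<open>In the open set \<open>W\<close> left after removing the closure of the union, every
  \<open>A i\<close> is meager, hence so is \<open>B\<close>. Since \<open>W\<close> consists of
  nonmeager points of \<open>B\<close>, it is empty, and only the frontier of an open set
  remains.\<close>

lemma nonmeager_points_interior_split:
  fixes A :: "'i::countable \<Rightarrow> 'a::second_countable_topology set"
  assumes "B \<subseteq> (\<Union>i. A i)"
  shows "meager (interior (nonmeager_points B) - (\<Union>i. interior (nonmeager_points (A i))))"
proof -
  let ?G = "\<Union>i. interior (nonmeager_points (A i))"
  define W where "W = interior (nonmeager_points B) - closure ?G"
  have "open W" unfolding W_def by (simp add: open_Diff)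
  have "meager (W \<inter> A i)" for i
  proof (rule meager_subset)
    show "meager ((A i - nonmeager_points (A i)) \<union>
        (nonmeager_points (A i) - interior (nonmeager_points (A i))))"
      by (intro meager_Un meager_Diff_nonmeager_points meager_frontier_closed closed_nonmeager_points)
    show "W \<inter> A i \<subseteq> (A i - nonmeager_points (A i)) \<union>
        (nonmeager_points (A i) - interior (nonmeager_points (A i)))"
      using closure_subset[of ?G] unfolding W_def by blast
  qed
  then have "meager (\<Union>i. W \<inter> A i)"
    by (intro meager_countable_Union) auto
  then have "meager (W \<inter> B)" using assms by (elim meager_subset) blast
  then have "W = {}"
    using \<open>open W\<close> interior_subset[of "nonmeager_points B"]
    unfolding nonmeager_points_def W_def by blast
  then have "interior (nonmeager_points B) - ?G \<subseteq> closure ?G - ?G"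
    unfolding W_def by blast
  moreover have "meager (closure ?G - ?G)" by (rule meager_frontier_open) auto
  ultimately show ?thesis by (rule meager_subset[rotated])
qed

text \<open>The open set is the interior of the points where \<open>A \<sigma>\<close> is locally nonmeager. Up to a meager set it is
  covered by the corresponding sets of the \<open>A (\<sigma> @ [i])\<close>, so a generic point of it can be followed
  along a whole branch \<open>\<tau>\<close>.\<close>

lemma nonmeager_Souslin:
  fixes A :: "'i::countable list \<Rightarrow> 'a::second_countable_topology set"
  assumes A: "\<And>\<sigma>. A \<sigma> \<subseteq> (\<Union>i. A (\<sigma> @ [i]))" and "\<not> meager (A \<sigma>)"
  obtains V where "open V" "V \<noteq> {}"
    "meager (V - {x. \<exists>\<tau>. \<forall>n. x \<in> closure (A (\<sigma> @ map \<tau> [0..<n]))})"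
proof -
  define V where "V \<sigma> = interior (nonmeager_points (A \<sigma>))" for \<sigma>
  \<comment> \<open>Collects, over the countably many nodes, the points in the hull of a node that
    lie in the hull of no child.\<close>
  define M where "M = (\<Union>\<sigma>. V \<sigma> - (\<Union>i. V (\<sigma> @ [i])))"
  have M: "meager M"
    unfolding M_def V_def by (intro meager_countable_Union nonmeager_points_interior_split A) auto
  have "V \<sigma> \<noteq> {}"
  proof
    assume "V \<sigma> = {}"
    then have "meager ((A \<sigma> - nonmeager_points (A \<sigma>)) \<union> nonmeager_points (A \<sigma>))"
      by (intro meager_Un meager_Diff_nonmeager_points meager_closed closed_nonmeager_points)
        (simp add: V_def)
    then have "meager (A \<sigma>)" by (rule meager_subset) blast
    then show False using assms(2) by simp
  qed
  moreover have "V \<sigma> - {x. \<exists>\<tau>. \<forall>n. x \<in> closure (A (\<sigma> @ map \<tau> [0..<n]))} \<subseteq> M"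
  proof
    fix x assume x: "x \<in> V \<sigma> - {x. \<exists>\<tau>. \<forall>n. x \<in> closure (A (\<sigma> @ map \<tau> [0..<n]))}"
    show "x \<in> M"
    proof (rule ccontr)
      assume "x \<notin> M"
      then have step: "\<exists>i. x \<in> V (\<rho> @ [i])" if "x \<in> V \<rho>" for \<rho>
        using that unfolding M_def by blast
      \<comment> \<open>Outside \<open>M\<close> a child can always be chosen, and recursive choice
        produces the branch.\<close>
      define g where "g = rec_nat \<sigma> (\<lambda>n \<rho>. \<rho> @ [SOME i. x \<in> V (\<rho> @ [i])])"
      define \<tau> where "\<tau> n = (SOME i. x \<in> V (g n @ [i]))" for n
      have g: "g 0 = \<sigma>" "\<And>n. g (Suc n) = g n @ [\<tau> n]" unfolding g_def \<tau>_def by simp_all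
      have "x \<in> V (g n)" for n
      proof (induction n)
        case (Suc n)
        then show ?case unfolding g \<tau>_def using someI_ex[OF step] by blast
      qed (use x g in simp)
      moreover have "g n = \<sigma> @ map \<tau> [0..<n]" for n
        by (induction n) (simp_all add: g)
      moreover have "V \<rho> \<subseteq> closure (A \<rho>)" for \<rho>
        unfolding V_def using interior_subset nonmeager_points_subset_closure by blast
      ultimately have "\<forall>n. x \<in> closure (A (\<sigma> @ map \<tau> [0..<n]))" by (metis subsetD)
      then show False using x by blast
    qed
  qed
  ultimately show ?thesis
    using that[of "V \<sigma>"] meager_subset[OF M] by (simp add: V_def)
qed

section \<open>Category in the Cantor space\<close>

lemma open_agree: "open {t :: nat \<Rightarrow> 'a::discrete_topology. \<forall>i<N. t i = a i}"
  using product_topology_basis'[of "{..<N}" "\<lambda>i. {a i}" "\<lambda>i. i"]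
  by (simp add: open_discrete lessThan_def)

lemma open_contains_agree:
  fixes U :: "(nat \<Rightarrow> 'a::topological_space) set"
  assumes "open U" "a \<in> U"
  obtains N where "\<And>t. (\<forall>i<N. t i = a i) \<Longrightarrow> t \<in> U"
proof -
  have "openin (product_topology (\<lambda>i. euclidean) UNIV) U"
    using assms(1) unfolding open_fun_def by auto
  from product_topology_open_contains_basis[OF this assms(2)]
  obtain X where X: "a \<in> (\<Pi>\<^sub>E i\<in>UNIV. X i)" "finite {i. X i \<noteq> UNIV}" "(\<Pi>\<^sub>E i\<in>UNIV. X i) \<subseteq> U"
    by auto
  obtain N where N: "{i. X i \<noteq> UNIV} \<subseteq> {..<N}"
    using finite_nat_iff_bounded X(2) by blast
  have "t \<in> U" if "\<forall>i<N. t i = a i" for t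
  proof -
    have "t i \<in> X i" for i
      using that N X(1) by (cases "i < N") (auto simp: PiE_iff)
    then show ?thesis using X(3) by (auto simp: PiE_iff)
  qed
  then show ?thesis using that by blast
qed

lemma open_contains_agree_prod:
  fixes U :: "((nat \<Rightarrow> 'a::topological_space) \<times> (nat \<Rightarrow> 'b::topological_space)) set"
  assumes "open U" "(a, b) \<in> U"
  obtains N where "\<And>t s. (\<forall>i<N. t i = a i) \<Longrightarrow> (\<forall>i<N. s i = b i) \<Longrightarrow> (t, s) \<in> U"
proof -
  obtain A B where AB: "open A" "open B" "a \<in> A" "b \<in> B" "A \<times> B \<subseteq> U"
    using open_prod_elim[OF assms] by (metis mem_Sigma_iff)
  obtain N where "\<And>t. (\<forall>i<N. t i = a i) \<Longrightarrow> t \<in> A"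
    using open_contains_agree[OF AB(1,3)] by blast
  moreover obtain M where "\<And>t. (\<forall>i<M. t i = b i) \<Longrightarrow> t \<in> B"
    using open_contains_agree[OF AB(2,4)] by blast
  ultimately show ?thesis
    using that[of "max N M"] AB(5) by (auto simp: subset_iff)
qed

text \<open>Induction on \<open>P\<close>: the block built so far is lengthened until it also forces
  the new pair into \<open>D\<close>. The earlier pairs stay in \<open>D\<close> because the longer
  block begins with the old one.\<close>

lemma finite_pairs_block:
  fixes D :: "((nat \<Rightarrow> bool) \<times> (nat \<Rightarrow> bool)) set"
  assumes D: "open D" "closure D = UNIV" and "finite P"
  shows "\<exists>M>N. \<exists>p q. \<forall>a b c d. (a, b) \<in> P \<longrightarrow>
    (\<forall>i<N. c i = a i \<and> d i = b i) \<longrightarrow> (\<forall>i\<in>{N..<M}. c i = p i \<and> d i = q i) \<longrightarrow> (c, d) \<in> D"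
  using assms(3)
proof (induction P)
  case (insert ab P)
  obtain a b where ab: "ab = (a, b)" by force
  obtain M p q where M: "M > N" and pq: "\<forall>a b c d. (a, b) \<in> P \<longrightarrow>
      (\<forall>i<N. c i = a i \<and> d i = b i) \<longrightarrow> (\<forall>i\<in>{N..<M}. c i = p i \<and> d i = q i) \<longrightarrow> (c, d) \<in> D"
    using insert.IH by blast
  \<comment> \<open>The stem of the new pair followed by the old block. Density puts a point of
    \<open>D\<close> into the resulting box, and openness of \<open>D\<close> leaves only finitely
    many coordinates to prescribe.\<close>
  define c0 where "c0 i = (if i < N then a i else p i)" for i
  define d0 where "d0 i = (if i < N then b i else q i)" for i
  define W where "W = {t. \<forall>i<M. t i = c0 i} \<times> {t. \<forall>i<M. t i = d0 i}"
  have "open W" unfolding W_def by (intro open_Times open_agree)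
  moreover have "(c0, d0) \<in> W" by (simp add: W_def)
  ultimately have "W \<inter> D \<noteq> {}"
    using open_Int_closure_eq_empty[of W D] D(2) by auto
  then obtain c1 d1 where W: "(c1, d1) \<in> W" and 1: "(c1, d1) \<in> D"
    by auto
  obtain K where K: "\<And>t s. (\<forall>i<K. t i = c1 i) \<Longrightarrow> (\<forall>i<K. s i = d1 i) \<Longrightarrow> (t, s) \<in> D"
    using open_contains_agree_prod[OF D(1) 1] by blast
  have "(c, d) \<in> D" if cd: "(a', b') \<in> insert ab P" "\<forall>i<N. c i = a' i \<and> d i = b' i"
    "\<forall>i\<in>{N..<max K M}. c i = c1 i \<and> d i = d1 i" for a' b' c d
  proof (cases "(a', b') = ab")
    case True
    have "c i = c1 i \<and> d i = d1 i" if "i < K" for i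
    proof (cases "i < N")
      case True
      then have "i < M" using M by simp
      then show ?thesis using True cd(2) W \<open>(a', b') = ab\<close> by (auto simp: c0_def d0_def ab W_def)
    next
      case False
      then show ?thesis using that cd(3) by auto
    qed
    then show ?thesis using K by blast
  next
    case False
    then have "(a', b') \<in> P" using cd(1) by auto
    moreover have "c i = p i \<and> d i = q i" if "i \<in> {N..<M}" for i
      using that cd(3) W by (auto simp: c0_def d0_def W_def)
    ultimately show ?thesis using pq[rule_format, of a' b' c d] cd(2) by blast
  qed
  then show ?case
    using M by (intro exI[of _ "max K M"] conjI exI[of _ c1] exI[of _ d1]) auto
qed auto

text \<open>There are only finitely many stems of length \<open>N\<close>, represented in
  \<open>P\<close> by sequences that are \<open>False\<close> from \<open>N\<close> on, so one block
  can serve whatever precedes it.\<close>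

lemma dense_open_block:
  fixes D :: "((nat \<Rightarrow> bool) \<times> (nat \<Rightarrow> bool)) set"
  assumes D: "open D" "closure D = UNIV"
  obtains M p q where "M > N"
    "\<And>c d. (\<And>i. N \<le> i \<Longrightarrow> i < M \<Longrightarrow> c i = p i \<and> d i = q i) \<Longrightarrow> (c, d) \<in> D"
proof -
  define P :: "(nat \<Rightarrow> bool) set" where "P = (\<lambda>S i. i \<in> S) ` Pow {..<N}"
  have "finite (P \<times> P)" unfolding P_def by simp
  from finite_pairs_block[OF D this, of N]
  obtain M p q where M: "M > N" and pq: "\<forall>a b c d. (a, b) \<in> P \<times> P \<longrightarrow>
      (\<forall>i<N. c i = a i \<and> d i = b i) \<longrightarrow> (\<forall>i\<in>{N..<M}. c i = p i \<and> d i = q i) \<longrightarrow> (c, d) \<in> D"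
    by blast
  have "(c, d) \<in> D" if cd: "\<And>i. N \<le> i \<Longrightarrow> i < M \<Longrightarrow> c i = p i \<and> d i = q i" for c d
  proof -
    define r where "r e = (\<lambda>i. i \<in> {i. i < N \<and> e i})" for e :: "nat \<Rightarrow> bool"
    have "r e \<in> P" for e unfolding r_def P_def by (rule imageI) auto
    then have "(r c, r d) \<in> P \<times> P" by simp
    from pq[rule_format, OF this, of c d] show ?thesis using cd by (simp add: r_def)
  qed
  then show ?thesis by (rule that[OF M])
qed

text \<open>Cut points \<open>N n\<close> and sequences \<open>p\<close>, \<open>q\<close> are chosen such that any two sequences that follow \<open>p\<close> resp. \<open>q\<close> on
  the \<open>n\<close>-th block form a pair in the \<open>n\<close>-th dense open set; \<open>f x\<close> follows \<open>p\<close> or \<open>q\<close> on that block according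
  to \<open>x n\<close>. Since only pairs with \<open>\<not> x n\<close> and \<open>y n\<close> are controlled, the conclusion is a disjunction.\<close>

lemma E0_embeds_avoiding_meager:
  fixes R :: "((nat \<Rightarrow> bool) \<times> (nat \<Rightarrow> bool)) set"
  assumes "meager R"
  obtains f :: "(nat \<Rightarrow> bool) \<Rightarrow> nat \<Rightarrow> bool" where "continuous_on UNIV f"
    "\<And>x y. E0 x y \<Longrightarrow> E0 (f x) (f y)"
    "\<And>x y. \<not> E0 x y \<Longrightarrow> (f x, f y) \<notin> R \<or> (f y, f x) \<notin> R"
proof -
  obtain F where F: "\<And>n::nat. closed (F n)" "\<And>n. interior (F n) = {}" "R \<subseteq> (\<Union>n. F n)"
    using assms unfolding meager_def by blast
  \<comment> \<open>These sets decrease, so membership in \<open>D m\<close> for arbitrarily large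
    \<open>m\<close> keeps a pair out of every \<open>F n\<close>.\<close>
  define D where "D n = - (\<Union>i\<le>n. F i)" for n
  have D: "open (D n)" "closure (D n) = UNIV" for n
  proof -
    show "open (D n)" unfolding D_def using F(1) by (auto intro!: open_Compl closed_UN)
    have "interior (\<Union>i\<le>n. F i) = {}"
    proof (induction n)
      case (Suc n)
      then show ?case using F(1) F(2)
        by (simp add: atMost_Suc interior_closed_Un_empty_interior Un_commute[of "F (Suc n)"] closed_UN)
    qed (use F(2) in simp)
    then show "closure (D n) = UNIV" unfolding D_def closure_complement by simp
  qed
  define ok where "ok n N M p q \<longleftrightarrow> N < M \<and>
      (\<forall>c d. (\<forall>i. N \<le> i \<longrightarrow> i < M \<longrightarrow> c i = p i \<and> d i = q i) \<longrightarrow> (c, d) \<in> D n)"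
    for n N M :: nat and p q
  have "\<exists>M p q. ok n N M p q" for n N
  proof -
    obtain M p q where "M > N"
      "\<And>c d. (\<And>i. N \<le> i \<Longrightarrow> i < M \<Longrightarrow> c i = p i \<and> d i = q i) \<Longrightarrow> (c, d) \<in> D n"
      by (rule dense_open_block[OF D]) blast
    then have "ok n N M p q" unfolding ok_def by simp
    then show ?thesis by blast
  qed
  then obtain M p' q' where ok: "\<And>n N. ok n N (M n N) (p' n N) (q' n N)" by metis
  define N where "N = rec_nat 0 M"
  define p where "p n = p' n (N n)" for n
  define q where "q n = q' n (N n)" for n
  have ok': "ok n (N n) (N (Suc n)) (p n) (q n)" for n
    using ok[of n "N n"] by (simp add: N_def p_def q_def)
  then have N: "N n < N (Suc n)" for n unfolding ok_def by blast
  have pq: "(c, d) \<in> D n" if "\<And>i. N n \<le> i \<Longrightarrow> i < N (Suc n) \<Longrightarrow> c i = p n i \<and> d i = q n i" for n c d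
    using ok'[of n] that unfolding ok_def by simp
  have "strict_mono N" using N by (simp add: strict_mono_Suc_iff)
  \<comment> \<open>The number of the block that contains the coordinate \<open>i\<close>.\<close>
  define k where "k i = (LEAST n. i < N (Suc n))" for i
  have ex: "i < N (Suc i)" for i using strict_mono_imp_increasing[OF \<open>strict_mono N\<close>, of "Suc i"] by simp
  have k_eq: "k i = n" if "N n \<le> i" "i < N (Suc n)" for i n
    unfolding k_def
  proof (rule Least_equality)
    fix m assume "i < N (Suc m)"
    then have "N n < N (Suc m)" using that by simp
    then show "n \<le> m" using \<open>strict_mono N\<close> by (simp add: strict_mono_less)
  qed (fact that(2))
  have k_ge: "n \<le> k i" if "N n \<le> i" for n i
  proof -
    have "i < N (Suc (k i))" unfolding k_def by (rule LeastI_ex) (use ex in blast)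
    then have "N n < N (Suc (k i))" using that by simp
    then show ?thesis using \<open>strict_mono N\<close> by (simp add: strict_mono_less)
  qed
  define f where "f x i = (if x (k i) then q (k i) i else p (k i) i)" for x :: "nat \<Rightarrow> bool" and i
  have "continuous_on UNIV (\<lambda>x. f x i)" for i
  proof -
    have "continuous_on UNIV ((\<lambda>b. if b then q (k i) i else p (k i) i) \<circ> (\<lambda>x. x (k i)))"
      by (intro continuous_on_compose continuous_on_product_coordinates) (simp add: continuous_on_open_vimage open_discrete)
    then show ?thesis by (simp add: f_def o_def)
  qed
  then have "continuous_on UNIV f" by (rule continuous_on_coordinatewise_then_product)
  moreover have "E0 (f x) (f y)" if E: "E0 x y" for x y
  proof -
    obtain n where "\<forall>m\<ge>n. x m = y m" using E unfolding E0_def by blast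
    then have "\<forall>i\<ge>N n. f x i = f y i" using k_ge unfolding f_def by simp
    then show ?thesis unfolding E0_def by blast
  qed
  moreover have *: "(f x, f y) \<notin> R" if "\<forall>n. \<exists>m\<ge>n. \<not> x m \<and> y m" for x y
  proof
    assume "(f x, f y) \<in> R"
    then obtain n where n: "(f x, f y) \<in> F n" using F(3) by blast
    obtain m where m: "m \<ge> n" "\<not> x m" "y m" using \<open>\<forall>n. \<exists>m\<ge>n. \<not> x m \<and> y m\<close> by blast
    have "(f x, f y) \<in> D m" by (rule pq) (simp add: f_def k_eq m)
    then show False using n m(1) unfolding D_def by blast
  qed
  moreover have "(f x, f y) \<notin> R \<or> (f y, f x) \<notin> R" if "\<not> E0 x y" for x y
  proof -
    \<comment> \<open>Inequivalent sequences differ infinitely often, hence infinitely often in one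
      of the two directions.\<close>
    have "(\<forall>n. \<exists>m\<ge>n. \<not> x m \<and> y m) \<or> (\<forall>n. \<exists>m\<ge>n. \<not> y m \<and> x m)"
    proof (rule ccontr)
      assume "\<not> ?thesis"
      then obtain n n' where "\<forall>m\<ge>n. \<not> (\<not> x m \<and> y m)" "\<forall>m\<ge>n'. \<not> (\<not> y m \<and> x m)" by blast
      then have "\<forall>m\<ge>max n n'. x m = y m" by auto
      then show False using that unfolding E0_def by blast
    qed
    then show ?thesis using * by blast
  qed
  ultimately show ?thesis using that by blast
qed

section \<open>Baire category and sections of comeager sets\<close>

lemma Baire_open_diff_meager:
  fixes V :: "'a::topological_space set"
  assumes "completely_metrizable_space (euclidean :: 'a topology)"
    and "open V" "V \<noteq> {}" "meager S"
  shows "\<not> V \<subseteq> S"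
proof
  assume "V \<subseteq> S"
  obtain F where F: "\<And>n::nat. closed (F n)" "\<And>n. interior (F n) = {}" "S \<subseteq> (\<Union>n. F n)"
    using assms(4) unfolding meager_def by blast
  have "euclidean interior_of \<Union>(range F) = {}"
    using F by (intro Baire_category_alt) (use assms(1) in auto)
  then have "interior (\<Union>n. F n) = {}" by simp
  moreover have "V \<subseteq> interior (\<Union>n. F n)"
    using F(3) \<open>V \<subseteq> S\<close> assms(2) by (intro interior_maximal) auto
  ultimately show False using assms(3) by blast
qed

text \<open>An open map sends the interior of the preimage of \<open>F n\<close> to an open subset
  of \<open>F n\<close>, which must be empty.\<close>

lemma meager_vimage_open_map:
  assumes g: "continuous_on UNIV g" "\<And>W. open W \<Longrightarrow> open (g ` W)" and "meager S"
  shows "meager (g -` S)"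
proof -
  obtain F where F: "\<And>n::nat. closed (F n)" "\<And>n. interior (F n) = {}" "S \<subseteq> (\<Union>n. F n)"
    using assms(3) unfolding meager_def by blast
  have "interior (g -` F n) = {}" for n
  proof -
    have "g ` interior (g -` F n) \<subseteq> interior (F n)"
      using interior_subset[of "g -` F n"] by (intro interior_maximal g(2)) auto
    then show ?thesis using F(2) by auto
  qed
  moreover have "closed (g -` F n)" for n using F(1) g(1) by (rule closed_vimage)
  moreover have "g -` S \<subseteq> (\<Union>n. g -` F n)"
    using vimage_mono[OF F(3)] by (simp add: vimage_UN)
  ultimately show ?thesis
    unfolding meager_def by (intro exI[of _ "\<lambda>n. g -` F n"]) simp
qed

lemma completely_metrizable_Cantor:
  "completely_metrizable_space (euclidean :: (nat \<Rightarrow> bool) topology)"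
proof -
  have "discrete_topology UNIV = (euclidean :: bool topology)"
    by (simp add: discrete_topology_unique open_discrete)
  then have "completely_metrizable_space (euclidean :: bool topology)"
    by (metis completely_metrizable_space_discrete_topology)
  then have "completely_metrizable_space (product_topology (\<lambda>i::nat. euclidean :: bool topology) UNIV)"
    by (simp add: completely_metrizable_space_product_topology)
  then show ?thesis by (simp add: euclidean_product_topology)
qed

text \<open>\<open>E0\<close> is the union of the closed sets \<open>H N\<close>, and each has empty
  interior because a basic box leaves some coordinate beyond \<open>N\<close> free.\<close>

lemma meager_E0: "meager {(t, t'). E0 t t'}"
proof -
  define H where "H N = {(t, t' :: nat \<Rightarrow> bool). \<forall>n\<ge>N. t n = t' n}" for N :: nat
  have "meager (H N)" for N
  proof (rule meager_closed)
    have "H N = (\<Inter>n\<in>{N..}. {u. fst u n = snd u n})" unfolding H_def by auto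
    moreover have "closed {u :: (nat \<Rightarrow> bool) \<times> (nat \<Rightarrow> bool). fst u n = snd u n}" for n
    proof (rule closed_Collect_eq)
      show "continuous_on UNIV (\<lambda>u :: (nat \<Rightarrow> bool) \<times> (nat \<Rightarrow> bool). fst u n)"
        by (rule continuous_on_product_then_coordinatewise) (intro continuous_intros)
      show "continuous_on UNIV (\<lambda>u :: (nat \<Rightarrow> bool) \<times> (nat \<Rightarrow> bool). snd u n)"
        by (rule continuous_on_product_then_coordinatewise) (intro continuous_intros)
    qed
    ultimately show "closed (H N)" by auto
    show "interior (H N) = {}"
    proof (rule ccontr)
      assume "interior (H N) \<noteq> {}"
      then obtain a b where ab: "(a, b) \<in> interior (H N)" by auto
      obtain K where K: "\<And>t s. (\<forall>i<K. t i = a i) \<Longrightarrow> (\<forall>i<K. s i = b i) \<Longrightarrow> (t, s) \<in> interior (H N)"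
        using open_contains_agree_prod[OF open_interior ab] by blast
      let ?m = "max K N"
      have "(a(?m := True), b(?m := False)) \<in> interior (H N)" by (rule K) auto
      then have "(a(?m := True), b(?m := False)) \<in> H N" using interior_subset by blast
      then show False unfolding H_def by (auto dest: spec[of _ ?m])
    qed
  qed
  then have "meager (\<Union>N. H N)" by (intro meager_countable_Union) auto
  then show ?thesis by (rule meager_subset) (auto simp: H_def E0_def)
qed

text \<open>A Baire argument in the space of triples \<open>((t, t'), s)\<close>: the projections to
  \<open>(t, s)\<close> and \<open>(t', s)\<close> are continuous and open, so the preimages of
  \<open>V - B\<close> under both, together with the triples satisfying \<open>E0 t t'\<close>, form
  a meager set.\<close>

lemma comeager_two_points_in_section:
  fixes V :: "((nat \<Rightarrow> bool) \<times> (nat \<Rightarrow> bool)) set"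
  assumes V: "open V" "V \<noteq> {}" "meager (V - B)"
  obtains t t' s where "(t, s) \<in> B" "(t', s) \<in> B" "t n = t' n" "\<not> E0 t t'"
proof -
  obtain a b where ab: "(a, b) \<in> V" using V(2) by auto
  obtain N where N: "\<And>t s. (\<forall>i<N. t i = a i) \<Longrightarrow> (\<forall>i<N. s i = b i) \<Longrightarrow> (t, s) \<in> V"
    using open_contains_agree_prod[OF V(1) ab] by blast
  let ?g = "\<lambda>u :: ((nat \<Rightarrow> bool) \<times> (nat \<Rightarrow> bool)) \<times> (nat \<Rightarrow> bool). (fst (fst u), snd u)"
  let ?h = "\<lambda>u :: ((nat \<Rightarrow> bool) \<times> (nat \<Rightarrow> bool)) \<times> (nat \<Rightarrow> bool). (snd (fst u), snd u)"
  \<comment> \<open>Both \<open>t\<close> and \<open>t'\<close> follow \<open>a\<close> up to and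
    including the coordinate \<open>n\<close>, whence \<open>t n = t' n\<close>.\<close>
  let ?W = "({t. \<forall>i<max N (Suc n). t i = a i} \<times> {t. \<forall>i<max N (Suc n). t i = a i}) \<times>
    {t. \<forall>i<N. t i = b i}"
  have og: "open (?g ` W)" if "open W" for W
  proof -
    have "open ((\<lambda>v. ((fst v, t'), snd v)) -` W)" for t'
      by (rule open_vimage[OF that]) (intro continuous_intros)
    moreover have "?g ` W = (\<Union>t'. (\<lambda>v. ((fst v, t'), snd v)) -` W)" by force
    ultimately show ?thesis by auto
  qed
  have oh: "open (?h ` W)" if "open W" for W
  proof -
    have "open ((\<lambda>v. ((t, fst v), snd v)) -` W)" for t
      by (rule open_vimage[OF that]) (intro continuous_intros)
    moreover have "?h ` W = (\<Union>t. (\<lambda>v. ((t, fst v), snd v)) -` W)" by force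
    ultimately show ?thesis by auto
  qed
  have "meager (?g -` (V - B) \<union> ?h -` (V - B) \<union> fst -` {(t, t'). E0 t t'})"
    by (intro meager_Un meager_vimage_open_map og oh V(3) meager_E0 continuous_intros open_image_fst)
      auto
  moreover have "open ?W" by (intro open_Times open_agree)
  moreover have "?W \<noteq> {}" by blast
  moreover have "completely_metrizable_space
      (euclidean :: (((nat \<Rightarrow> bool) \<times> (nat \<Rightarrow> bool)) \<times> (nat \<Rightarrow> bool)) topology)"
    unfolding prod_topology_euclidean[symmetric] completely_metrizable_space_prod_topology
    using completely_metrizable_Cantor by simp
  ultimately have "\<not> ?W \<subseteq> ?g -` (V - B) \<union> ?h -` (V - B) \<union> fst -` {(t, t'). E0 t t'}"
    (is "\<not> _ \<subseteq> ?S")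
    by (intro Baire_open_diff_meager)
  then obtain u where "u \<in> ?W" "u \<notin> ?S" by (meson subsetI)
  moreover obtain t t' s where "u = ((t, t'), s)" by (metis prod.exhaust)
  ultimately have ts: "((t, t'), s) \<in> ?W" "((t, t'), s) \<notin> ?S" by simp_all
  have "(t, s) \<in> V" "(t', s) \<in> V" using ts(1) by (auto intro!: N)
  then show ?thesis using ts by (intro that[of t s t']) auto
qed

section \<open>Graphs of isomorphisms\<close>

text \<open>Graphs, unlike operators, have lower limits when the domain and the range vary.\<close>

definition iso_graph :: "real \<Rightarrow> ('a::real_normed_vector \<times> 'b::real_normed_vector) set \<Rightarrow> 'a set \<Rightarrow> 'b set \<Rightarrow> bool" where
  "iso_graph K \<Gamma> F G \<longleftrightarrow> subspace \<Gamma> \<and> fst ` \<Gamma> = F \<and> snd ` \<Gamma> = G \<and>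
     (\<forall>x y. (x, y) \<in> \<Gamma> \<longrightarrow> norm y \<le> K * norm x \<and> norm x \<le> K * norm y)"

section \<open>Algebra of graphs\<close>

lemma iso_graph_add: "iso_graph K \<Gamma> F G \<Longrightarrow> (x, y) \<in> \<Gamma> \<Longrightarrow> (x', y') \<in> \<Gamma> \<Longrightarrow> (x + x', y + y') \<in> \<Gamma>"
  unfolding iso_graph_def using subspace_add[of \<Gamma> "(x, y)" "(x', y')"] by simp

lemma iso_graph_diff: "iso_graph K \<Gamma> F G \<Longrightarrow> (x, y) \<in> \<Gamma> \<Longrightarrow> (x', y') \<in> \<Gamma> \<Longrightarrow> (x - x', y - y') \<in> \<Gamma>"
  unfolding iso_graph_def using subspace_diff[of \<Gamma> "(x, y)" "(x', y')"] by simp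

lemma iso_graph_scale: "iso_graph K \<Gamma> F G \<Longrightarrow> (x, y) \<in> \<Gamma> \<Longrightarrow> (c *\<^sub>R x, c *\<^sub>R y) \<in> \<Gamma>"
  unfolding iso_graph_def using subspace_scale[of \<Gamma> "(x, y)" c] by simp

lemma iso_graph_zero: "iso_graph K \<Gamma> F G \<Longrightarrow> (0, 0) \<in> \<Gamma>"
  unfolding iso_graph_def using subspace_0[of \<Gamma>] by (simp add: zero_prod_def)

lemma iso_graph_norm:
  "iso_graph K \<Gamma> F G \<Longrightarrow> (x, y) \<in> \<Gamma> \<Longrightarrow> norm y \<le> K * norm x"
  "iso_graph K \<Gamma> F G \<Longrightarrow> (x, y) \<in> \<Gamma> \<Longrightarrow> norm x \<le> K * norm y"
  unfolding iso_graph_def by auto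

lemma iso_graph_domain: "iso_graph K \<Gamma> F G \<Longrightarrow> x \<in> F \<Longrightarrow> \<exists>y\<in>G. (x, y) \<in> \<Gamma>"
  unfolding iso_graph_def by force

lemma iso_graph_mem: "iso_graph K \<Gamma> F G \<Longrightarrow> (x, y) \<in> \<Gamma> \<Longrightarrow> x \<in> F \<and> y \<in> G"
  unfolding iso_graph_def by force

lemma iso_graph_unique: "iso_graph K \<Gamma> F G \<Longrightarrow> (x, y) \<in> \<Gamma> \<Longrightarrow> (x, y') \<in> \<Gamma> \<Longrightarrow> y = y'"
  using iso_graph_norm(1)[of K \<Gamma> F G "x - x" "y - y'"] iso_graph_diff[of K \<Gamma> F G x y x y'] by simp

lemma iso_graph_converse:
  assumes "iso_graph K \<Gamma> F G"
  shows "iso_graph K (\<Gamma>\<inverse>) G F"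
proof -
  have "subspace (\<Gamma>\<inverse>)"
    unfolding subspace_def using assms iso_graph_add[OF assms] iso_graph_scale[OF assms]
    by (auto simp: iso_graph_def zero_prod_def dest: subspace_0)
  then show ?thesis using assms unfolding iso_graph_def by (auto simp: image_iff) force+
qed

lemma iso_graph_comp:
  assumes \<Gamma>: "iso_graph K \<Gamma> F G" and \<Delta>: "iso_graph L \<Delta> G H" and "0 \<le> K" "0 \<le> L"
  shows "iso_graph (K * L) (\<Gamma> O \<Delta>) F H"
  unfolding iso_graph_def
proof (intro conjI allI impI)
  show "subspace (\<Gamma> O \<Delta>)"
    unfolding subspace_def
  proof (intro conjI ballI allI)
    show "0 \<in> \<Gamma> O \<Delta>"
      unfolding zero_prod_def using iso_graph_zero[OF \<Gamma>] iso_graph_zero[OF \<Delta>] by blast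
  next
    fix u v assume "u \<in> \<Gamma> O \<Delta>" "v \<in> \<Gamma> O \<Delta>"
    then show "u + v \<in> \<Gamma> O \<Delta>"
      by (auto intro!: relcompI iso_graph_add[OF \<Gamma>] iso_graph_add[OF \<Delta>])
  next
    fix c u assume "u \<in> \<Gamma> O \<Delta>"
    then show "c *\<^sub>R u \<in> \<Gamma> O \<Delta>"
      by (auto intro!: relcompI iso_graph_scale[OF \<Gamma>] iso_graph_scale[OF \<Delta>])
  qed
  have "\<exists>z. (x, z) \<in> \<Gamma> O \<Delta>" if "x \<in> F" for x
    using iso_graph_domain[OF \<Gamma> that] iso_graph_domain[OF \<Delta>] by blast
  moreover have "\<exists>x. (x, z) \<in> \<Gamma> O \<Delta>" if "z \<in> H" for z
    using iso_graph_domain[OF iso_graph_converse[OF \<Delta>] that]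
      iso_graph_domain[OF iso_graph_converse[OF \<Gamma>]] by blast
  moreover have "x \<in> F \<and> z \<in> H" if "(x, z) \<in> \<Gamma> O \<Delta>" for x z
    using that iso_graph_mem[OF \<Gamma>] iso_graph_mem[OF \<Delta>] by blast
  ultimately show "fst ` (\<Gamma> O \<Delta>) = F" "snd ` (\<Gamma> O \<Delta>) = H"
    unfolding Domain_fst[symmetric] Range_snd[symmetric] by blast+
  fix x z assume "(x, z) \<in> \<Gamma> O \<Delta>"
  then obtain y where y: "(x, y) \<in> \<Gamma>" "(y, z) \<in> \<Delta>" by blast
  have "norm z \<le> L * norm y" using iso_graph_norm(1)[OF \<Delta> y(2)] .
  also have "\<dots> \<le> L * (K * norm x)" using iso_graph_norm(1)[OF \<Gamma> y(1)] assms(4) by (rule mult_left_mono)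
  finally show "norm z \<le> K * L * norm x" by (simp add: ac_simps)
  have "norm x \<le> K * norm y" using iso_graph_norm(2)[OF \<Gamma> y(1)] .
  also have "\<dots> \<le> K * (L * norm z)" using iso_graph_norm(2)[OF \<Delta> y(2)] assms(3) by (rule mult_left_mono)
  finally show "norm x \<le> K * L * norm z" by (simp add: ac_simps)
qed

text \<open>A pointwise choice of images is automatically linear, because
  \<open>iso_graph_unique\<close> leaves only one image for each point.\<close>

lemma iso_graph_operator:
  assumes \<Gamma>: "iso_graph K \<Gamma> F G"
  obtains T where "bounded_linear_on F G T" "\<And>x. x \<in> F \<Longrightarrow> (x, T x) \<in> \<Gamma>"
proof -
  obtain T where T: "\<And>x. x \<in> F \<Longrightarrow> (x, T x) \<in> \<Gamma>"
    using iso_graph_domain[OF \<Gamma>] by metis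
  have "bounded_linear_on F G T"
    unfolding bounded_linear_on_def
  proof (intro conjI ballI allI exI)
    show "T ` F \<subseteq> G" using T iso_graph_mem[OF \<Gamma>] by blast
    fix x assume x: "x \<in> F"
    show "T (x + y) = T x + T y" if "y \<in> F" for y
    proof -
      have *: "(x + y, T x + T y) \<in> \<Gamma>" using x that by (intro iso_graph_add[OF \<Gamma>] T)
      then have "x + y \<in> F" using iso_graph_mem[OF \<Gamma>] by blast
      then show ?thesis using iso_graph_unique[OF \<Gamma> T *] by blast
    qed
    show "T (c *\<^sub>R x) = c *\<^sub>R T x" for c
    proof -
      have *: "(c *\<^sub>R x, c *\<^sub>R T x) \<in> \<Gamma>" using x by (intro iso_graph_scale[OF \<Gamma>] T)
      then have "c *\<^sub>R x \<in> F" using iso_graph_mem[OF \<Gamma>] by blast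
      then show ?thesis using iso_graph_unique[OF \<Gamma> T *] by blast
    qed
    show "norm (T x) \<le> norm x * K"
      using iso_graph_norm(1)[OF \<Gamma> T[OF x]] by (simp add: mult.commute)
  qed
  then show ?thesis using T that by blast
qed

text \<open>Integer constants exhibit isomorphism as a countable union of relations, each with one
  bound for the operator and its inverse.\<close>

lemma isomorphic_subspaces_iff_iso_graph:
  assumes F: "subspace F"
  shows "isomorphic_subspaces F G \<longleftrightarrow> (\<exists>n::nat. \<exists>\<Gamma>. iso_graph (real n) \<Gamma> F G)"
proof
  assume "isomorphic_subspaces F G"
  then obtain T S where T: "bounded_linear_on F G T" and S: "bounded_linear_on G F S"
    and inv: "\<forall>x\<in>F. S (T x) = x" "\<forall>y\<in>G. T (S y) = y"
    unfolding isomorphic_subspaces_def by blast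
  obtain K where K: "\<forall>x\<in>F. norm (T x) \<le> norm x * K" using T unfolding bounded_linear_on_def by blast
  obtain L where L: "\<forall>x\<in>G. norm (S x) \<le> norm x * L" using S unfolding bounded_linear_on_def by blast
  obtain n where n: "max K L \<le> real n" using real_arch_simple by blast
  have TF: "T x \<in> G" if "x \<in> F" for x using T that unfolding bounded_linear_on_def by blast
  have SG: "S y \<in> F" if "y \<in> G" for y using S that unfolding bounded_linear_on_def by blast
  have add: "T (x + y) = T x + T y" if "x \<in> F" "y \<in> F" for x y
    using T that unfolding bounded_linear_on_def by blast
  have sc: "T (c *\<^sub>R x) = c *\<^sub>R T x" if "x \<in> F" for x c
    using T that unfolding bounded_linear_on_def by blast
  have "iso_graph n ((\<lambda>x. (x, T x)) ` F) F G"
    unfolding iso_graph_def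
  proof (intro conjI allI impI)
    have "T 0 = 0" using sc[of 0 0] subspace_0[OF F] by simp
    then show "subspace ((\<lambda>x. (x, T x)) ` F)"
      unfolding subspace_def using F add sc
      by (auto simp: zero_prod_def image_iff subspace_add subspace_scale subspace_0)
    show "fst ` (\<lambda>x. (x, T x)) ` F = F" by force
    show "snd ` (\<lambda>x. (x, T x)) ` F = G"
      using TF SG inv(2) by (auto simp: image_image image_iff) (metis)
    fix x y assume "(x, y) \<in> (\<lambda>x. (x, T x)) ` F"
    then have x: "x \<in> F" "y = T x" by auto
    have "norm y \<le> norm x * K" using K x by simp
    also have "\<dots> \<le> norm x * n" using n by (intro mult_left_mono) auto
    finally show "norm y \<le> n * norm x" by (simp add: mult.commute)
    have "norm x \<le> norm y * L" using L x inv(1) TF by metis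
    also have "\<dots> \<le> norm y * n" using n by (intro mult_left_mono) auto
    finally show "norm x \<le> n * norm y" by (simp add: mult.commute)
  qed
  then show "\<exists>n::nat. \<exists>\<Gamma>. iso_graph (real n) \<Gamma> F G" by blast
next
  assume "\<exists>n::nat. \<exists>\<Gamma>. iso_graph (real n) \<Gamma> F G"
  then obtain n :: nat and \<Gamma> where \<Gamma>: "iso_graph (real n) \<Gamma> F G" by blast
  obtain T where T: "bounded_linear_on F G T" "\<And>x. x \<in> F \<Longrightarrow> (x, T x) \<in> \<Gamma>"
    using iso_graph_operator[OF \<Gamma>] by blast
  obtain S where S: "bounded_linear_on G F S" "\<And>y. y \<in> G \<Longrightarrow> (y, S y) \<in> \<Gamma>\<inverse>"
    using iso_graph_operator[OF iso_graph_converse[OF \<Gamma>]] by blast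
  have "S (T x) = x" if "x \<in> F" for x
  proof -
    have "(T x, x) \<in> \<Gamma>\<inverse>" "T x \<in> G" using T(2)[OF that] iso_graph_mem[OF \<Gamma>] by blast+
    then show ?thesis using iso_graph_unique[OF iso_graph_converse[OF \<Gamma>] S(2)] by blast
  qed
  moreover have "T (S y) = y" if "y \<in> G" for y
  proof -
    have "(S y, y) \<in> \<Gamma>" "S y \<in> F" using S(2)[OF that] iso_graph_mem[OF \<Gamma>] by blast+
    then show ?thesis using iso_graph_unique[OF \<Gamma> T(2)] by blast
  qed
  ultimately show "isomorphic_subspaces F G"
    unfolding isomorphic_subspaces_def using T(1) S(1) by blast
qed

section \<open>Kuratowski lower limits of graphs\<close>

definition graph_liminf :: "(nat \<Rightarrow> 'a::metric_space set) \<Rightarrow> 'a set" where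
  "graph_liminf \<Gamma> = {p. \<forall>\<epsilon>>0. \<exists>N. \<forall>n\<ge>N. \<exists>p'\<in>\<Gamma> n. dist p p' < \<epsilon>}"

lemma closed_graph_liminf: "closed (graph_liminf \<Gamma>)"
proof -
  have "p \<in> graph_liminf \<Gamma>" if p: "p \<in> closure (graph_liminf \<Gamma>)" for p
    unfolding graph_liminf_def
  proof (intro CollectI allI impI)
    fix \<epsilon> :: real assume "\<epsilon> > 0"
    then obtain r where r: "r \<in> graph_liminf \<Gamma>" "dist r p < \<epsilon> / 2"
      using p closure_approachable[of p] by (meson half_gt_zero)
    then obtain N where N: "\<forall>n\<ge>N. \<exists>p'\<in>\<Gamma> n. dist r p' < \<epsilon> / 2"
      using \<open>\<epsilon> > 0\<close> unfolding graph_liminf_def by (auto dest: spec[of _ "\<epsilon> / 2"])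
    have "\<exists>p'\<in>\<Gamma> n. dist p p' < \<epsilon>" if "n \<ge> N" for n
      using N that r(2) by (metis dist_commute dist_triangle_half_r)
    then show "\<exists>N. \<forall>n\<ge>N. \<exists>p'\<in>\<Gamma> n. dist p p' < \<epsilon>" by blast
  qed
  then show ?thesis by (metis closure_subset closure_closed subsetI subset_antisym closed_closure)
qed

lemma subspace_graph_liminf:
  fixes \<Gamma> :: "nat \<Rightarrow> 'a::real_normed_vector set"
  assumes "\<And>n. subspace (\<Gamma> n)"
  shows "subspace (graph_liminf \<Gamma>)"
  unfolding subspace_def
proof (intro conjI ballI allI)
  show "0 \<in> graph_liminf \<Gamma>"
    unfolding graph_liminf_def using subspace_0[OF assms] by (auto intro!: exI[of _ 0] bexI[of _ 0])
next
  fix u v assume uv: "u \<in> graph_liminf \<Gamma>" "v \<in> graph_liminf \<Gamma>"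
  show "u + v \<in> graph_liminf \<Gamma>"
    unfolding graph_liminf_def
  proof (intro CollectI allI impI)
    fix \<epsilon> :: real assume "\<epsilon> > 0"
    then have e: "\<epsilon> / 2 > 0" by simp
    obtain N where N: "\<forall>n\<ge>N. \<exists>p'\<in>\<Gamma> n. dist u p' < \<epsilon> / 2"
      using uv(1) e unfolding graph_liminf_def by blast
    obtain M where M: "\<forall>n\<ge>M. \<exists>p'\<in>\<Gamma> n. dist v p' < \<epsilon> / 2"
      using uv(2) e unfolding graph_liminf_def by blast
    have "\<exists>p'\<in>\<Gamma> n. dist (u + v) p' < \<epsilon>" if n: "n \<ge> max N M" for n
    proof -
      obtain p where p: "p \<in> \<Gamma> n" "dist u p < \<epsilon> / 2" using N n by auto
      obtain r where r: "r \<in> \<Gamma> n" "dist v r < \<epsilon> / 2" using M n by auto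
      have "dist (u + v) (p + r) < \<epsilon>"
        using dist_triangle_add[of u v p r] p(2) r(2) by simp
      then show ?thesis using subspace_add[OF assms p(1) r(1)] by blast
    qed
    then show "\<exists>N. \<forall>n\<ge>N. \<exists>p'\<in>\<Gamma> n. dist (u + v) p' < \<epsilon>" by blast
  qed
next
  fix c u assume u: "u \<in> graph_liminf \<Gamma>"
  show "c *\<^sub>R u \<in> graph_liminf \<Gamma>"
    unfolding graph_liminf_def
  proof (intro CollectI allI impI)
    fix \<epsilon> :: real assume "\<epsilon> > 0"
    then have e: "\<epsilon> / (\<bar>c\<bar> + 1) > 0" by simp
    obtain N where N: "\<forall>n\<ge>N. \<exists>p'\<in>\<Gamma> n. dist u p' < \<epsilon> / (\<bar>c\<bar> + 1)"
      using u e unfolding graph_liminf_def by blast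
    have "\<exists>p'\<in>\<Gamma> n. dist (c *\<^sub>R u) p' < \<epsilon>" if n: "n \<ge> N" for n
    proof -
      obtain p where p: "p \<in> \<Gamma> n" "dist u p < \<epsilon> / (\<bar>c\<bar> + 1)" using N n by blast
      have "dist (c *\<^sub>R u) (c *\<^sub>R p) = \<bar>c\<bar> * dist u p"
        by (simp add: dist_norm flip: scaleR_diff_right)
      also have "\<dots> \<le> (\<bar>c\<bar> + 1) * dist u p" by (intro mult_right_mono) auto
      also have "\<dots> < \<epsilon>" using p(2) by (simp add: field_simps)
      finally show ?thesis using subspace_scale[OF assms p(1)] by blast
    qed
    then show "\<exists>N. \<forall>n\<ge>N. \<exists>p'\<in>\<Gamma> n. dist (c *\<^sub>R u) p' < \<epsilon>" by blast
  qed
qed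

lemma graph_liminf_converse: "(x, y) \<in> graph_liminf (\<lambda>n. (\<Gamma> n)\<inverse>) \<longleftrightarrow> (y, x) \<in> graph_liminf \<Gamma>"
proof -
  have "(\<exists>p\<in>(\<Gamma> n)\<inverse>. dist (x, y) p < \<epsilon>) \<longleftrightarrow> (\<exists>p\<in>\<Gamma> n. dist (y, x) p < \<epsilon>)" for n \<epsilon>
    by (force simp: dist_Pair_Pair add.commute)
  then show ?thesis unfolding graph_liminf_def by simp
qed

lemma graph_liminf_norm:
  assumes "\<And>n x y. (x, y) \<in> \<Gamma> n \<Longrightarrow> norm y \<le> K * norm x" "0 \<le> K" and "(x, y) \<in> graph_liminf \<Gamma>"
  shows "norm y \<le> K * norm x"
proof (rule field_le_epsilon)
  fix \<epsilon> :: real assume "\<epsilon> > 0"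
  \<comment> \<open>The error in the first coordinate enters \<open>K\<close> times and that in the
    second once, so together they cost \<epsilon>.\<close>
  then have e: "\<epsilon> / (K + 1) > 0" using assms(2) by simp
  then obtain n p where p: "p \<in> \<Gamma> n" "dist (x, y) p < \<epsilon> / (K + 1)"
    using assms(3) unfolding graph_liminf_def by blast
  obtain x' y' where p': "p = (x', y')" by force
  have "dist x x' < \<epsilon> / (K + 1)" "dist y y' < \<epsilon> / (K + 1)"
    using p(2) dist_fst_le[of "(x, y)" p] dist_snd_le[of "(x, y)" p] unfolding p' by auto
  then have xy: "norm (x' - x) \<le> \<epsilon> / (K + 1)" "norm (y - y') \<le> \<epsilon> / (K + 1)"
    by (auto simp: dist_norm norm_minus_commute)
  have "norm y \<le> norm y' + norm (y - y')" using norm_triangle_ineq[of y' "y - y'"] by simp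
  also have "\<dots> \<le> K * norm x' + \<epsilon> / (K + 1)"
    using assms(1) p(1) xy(2) unfolding p' by (intro add_mono) auto
  also have "\<dots> \<le> K * (norm x + \<epsilon> / (K + 1)) + \<epsilon> / (K + 1)"
    using norm_triangle_ineq[of x "x' - x"] xy(1) assms(2) by (intro add_mono mult_left_mono) auto
  also have "\<dots> = K * norm x + (K + 1) * (\<epsilon> / (K + 1))"
    by (simp only: distrib_left distrib_right mult_1_left add.assoc)
  also have "\<dots> = K * norm x + \<epsilon>" using assms(2) by simp
  finally show "norm y \<le> K * norm x + \<epsilon>" .
qed

text \<open>For all large \<open>n\<close> the image of \<open>x\<close> under
  \<open>\<Gamma> n\<close> is within \<open>1 / (m + 1)\<close> of \<open>v m\<close>. Comparing
  \<open>v m\<close> and \<open>v k\<close> with the image at a common index shows that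
  \<open>v\<close> is Cauchy, and the images then converge to its limit.\<close>

lemma graph_liminf_exists_image:
  fixes \<Gamma> :: "nat \<Rightarrow> ('a::real_normed_vector \<times> 'b::banach) set"
  assumes \<Gamma>: "\<And>n. iso_graph K (\<Gamma> n) (F n) (G n)"
    and v: "\<And>m. \<exists>N. \<forall>n\<ge>N. \<exists>y. (x, y) \<in> \<Gamma> n \<and> norm (y - v m) \<le> 1 / real (Suc m)"
  obtains y where "(x, y) \<in> graph_liminf \<Gamma>" "v \<longlonglongrightarrow> y" "\<And>m. norm (y - v m) \<le> 1 / real (Suc m)"
proof -
  have vv: "norm (v m - v k) \<le> 1 / real (Suc m) + 1 / real (Suc k)" for m k
  proof -
    obtain N where N: "\<forall>n\<ge>N. \<exists>y. (x, y) \<in> \<Gamma> n \<and> norm (y - v m) \<le> 1 / real (Suc m)" using v by blast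
    obtain M where M: "\<forall>n\<ge>M. \<exists>y. (x, y) \<in> \<Gamma> n \<and> norm (y - v k) \<le> 1 / real (Suc k)" using v by blast
    let ?n = "max N M"
    obtain y where y: "(x, y) \<in> \<Gamma> ?n" "norm (y - v m) \<le> 1 / real (Suc m)" using N by (meson max.cobounded1)
    obtain y' where y': "(x, y') \<in> \<Gamma> ?n" "norm (y' - v k) \<le> 1 / real (Suc k)" using M by (meson max.cobounded2)
    have "y' = y" using iso_graph_unique[OF \<Gamma> y'(1) y(1)] .
    have "norm (v m - v k) \<le> norm (y - v k) + norm (y - v m)"
      using norm_triangle_ineq4[of "y - v k" "y - v m"] by simp
    then show ?thesis using y y' \<open>y' = y\<close> by simp
  qed
  have lim0: "(\<lambda>m. 1 / real (Suc m)) \<longlonglongrightarrow> 0" using LIMSEQ_inverse_real_of_nat by (simp add: inverse_eq_divide)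
  have "Cauchy v"
  proof (rule metric_CauchyI)
    fix \<epsilon> :: real assume "\<epsilon> > 0"
    then obtain N where N: "1 / real (Suc N) < \<epsilon> / 2"
      using nat_approx_posE[of "\<epsilon> / 2"] by auto
    have "dist (v m) (v k) < \<epsilon>" if "m \<ge> N" "k \<ge> N" for m k
    proof -
      have "1 / real (Suc m) \<le> 1 / real (Suc N)" "1 / real (Suc k) \<le> 1 / real (Suc N)"
        using that by (simp_all add: frac_le)
      then show ?thesis using vv[of m k] N unfolding dist_norm by linarith
    qed
    then show "\<exists>M. \<forall>m\<ge>M. \<forall>n\<ge>M. dist (v m) (v n) < \<epsilon>" by blast
  qed
  then obtain y where y: "v \<longlonglongrightarrow> y" using Cauchy_convergent convergent_def by blast
  have yv: "norm (y - v m) \<le> 1 / real (Suc m)" for m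
  proof -
    have "(\<lambda>k. norm (v k - v m)) \<longlonglongrightarrow> norm (y - v m)" by (intro tendsto_intros y)
    moreover have "(\<lambda>k. 1 / real (Suc m) + 1 / real (Suc k)) \<longlonglongrightarrow> 1 / real (Suc m) + 0"
      by (intro tendsto_intros lim0)
    ultimately have "norm (y - v m) \<le> 1 / real (Suc m) + 0"
      by (rule LIMSEQ_le) (use vv norm_minus_commute in metis)
    then show ?thesis by simp
  qed
  have "(x, y) \<in> graph_liminf \<Gamma>"
    unfolding graph_liminf_def
  proof (intro CollectI allI impI)
    fix \<epsilon> :: real assume "\<epsilon> > 0"
    then obtain m where m: "1 / real (Suc m) < \<epsilon> / 2"
      using nat_approx_posE[of "\<epsilon> / 2"] by auto
    obtain N where N: "\<forall>n\<ge>N. \<exists>y. (x, y) \<in> \<Gamma> n \<and> norm (y - v m) \<le> 1 / real (Suc m)" using v by blast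
    have "\<exists>p'\<in>\<Gamma> n. dist (x, y) p' < \<epsilon>" if n: "n \<ge> N" for n
    proof -
      obtain y' where y': "(x, y') \<in> \<Gamma> n" "norm (y' - v m) \<le> 1 / real (Suc m)" using N n by blast
      have "norm (y - y') \<le> norm (y - v m) + norm (y' - v m)"
        using norm_triangle_ineq4[of "y - v m" "y' - v m"] by simp
      then have "dist (x, y) (x, y') < \<epsilon>"
        using yv[of m] y'(2) m by (simp add: dist_Pair_Pair dist_norm)
      then show ?thesis using y'(1) by blast
    qed
    then show "\<exists>N. \<forall>n\<ge>N. \<exists>p'\<in>\<Gamma> n. dist (x, y) p' < \<epsilon>" by blast
  qed
  then show ?thesis using y yv that by blast
qed

text \<open>On the graph the first projection is bounded below by \<open>1 / (1 + K)\<close>, so it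
  carries the complete graph to a complete set.\<close>

lemma closed_fst_image_bounded_graph:
  fixes \<Gamma> :: "('a::banach \<times> 'b::banach) set"
  assumes "subspace \<Gamma>" "closed \<Gamma>" "0 \<le> K" "\<And>x y. (x, y) \<in> \<Gamma> \<Longrightarrow> norm y \<le> K * norm x"
  shows "closed (fst ` \<Gamma>)"
proof -
  have "complete (fst ` \<Gamma>)"
  proof (rule complete_isometric_image)
    show "0 < 1 / (1 + K)" using assms(3) by simp
    show "\<forall>p\<in>\<Gamma>. 1 / (1 + K) * norm p \<le> norm (fst p)"
    proof
      fix p assume p: "p \<in> \<Gamma>"
      obtain x y where xy: "p = (x, y)" by force
      have "norm p \<le> norm x + norm y" unfolding xy by (rule norm_Pair_le)
      also have "\<dots> \<le> (1 + K) * norm x" using assms(4) p unfolding xy by (auto simp: algebra_simps)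
      finally show "1 / (1 + K) * norm p \<le> norm (fst p)"
        using assms(3) by (simp add: xy field_simps)
    qed
    show "complete \<Gamma>" using assms(2) by (simp add: complete_eq_closed)
  qed (use assms(1) bounded_linear_fst in auto)
  then show ?thesis by (simp add: complete_eq_closed)
qed

section \<open>The isomorphism relation as a Souslin scheme\<close>

text \<open>Branch spaces with abstract bookkeeping: \<open>b j\<close> is the coordinate of
  \<open>t\<close> that selects the bit of the \<open>j\<close>-th generator. The category argument
  is carried out in this generality.\<close>

definition seq_branch :: "(nat \<Rightarrow> bool \<Rightarrow> 'a::real_normed_vector) \<Rightarrow> (nat \<Rightarrow> nat) \<Rightarrow> (nat \<Rightarrow> bool) \<Rightarrow> 'a set" where
  "seq_branch e b t = closure (span (range (\<lambda>j. e j (t (b j)))))"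

text \<open>The lists do not depend on \<open>t\<close>, so one countable index set describes a
  dense subset of every branch.\<close>

definition rat_comb :: "(nat \<Rightarrow> bool \<Rightarrow> 'a::real_normed_vector) \<Rightarrow> (nat \<Rightarrow> nat) \<Rightarrow> (nat \<Rightarrow> bool) \<Rightarrow> (rat \<times> nat) list \<Rightarrow> 'a" where
  "rat_comb e b t q = (\<Sum>(r, j)\<leftarrow>q. real_of_rat r *\<^sub>R e j (t (b j)))"

lemma closed_seq_branch: "closed (seq_branch e b t)"
  unfolding seq_branch_def by simp

lemma subspace_closure:
  fixes S :: "'a::real_normed_vector set"
  assumes "subspace S"
  shows "subspace (closure S)"
  unfolding subspace_def
proof (intro conjI ballI allI)
  show "0 \<in> closure S" using subspace_0[OF assms] closure_subset by blast
  show "x + y \<in> closure S" if "x \<in> closure S" "y \<in> closure S" for x y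
  proof -
    have "(\<lambda>u. fst u + snd u) ` closure (S \<times> S) \<subseteq> closure S"
      by (rule image_closure_subset)
        (use subspace_add[OF assms] closure_subset[of S] in \<open>auto intro!: continuous_intros\<close>)
    then show ?thesis using that unfolding closure_Times by (auto simp: image_subset_iff)
  qed
  show "c *\<^sub>R x \<in> closure S" if "x \<in> closure S" for x c
  proof -
    have "(\<lambda>u. c *\<^sub>R u) ` closure S \<subseteq> closure S"
      by (rule image_closure_subset)
        (use subspace_scale[OF assms] closure_subset[of S] in \<open>auto intro!: continuous_intros\<close>)
    then show ?thesis using that by blast
  qed
qed

lemma subspace_seq_branch: "subspace (seq_branch e b t)"
  unfolding seq_branch_def by (intro subspace_closure subspace_span)

lemma mem_seq_branch: "e j (t (b j)) \<in> seq_branch e b t"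
  unfolding seq_branch_def by (rule subsetD[OF closure_subset]) (auto intro: span_base)

lemma seq_branch_minimal:
  assumes "closed S" "subspace S" "\<And>j. e j (t (b j)) \<in> S"
  shows "seq_branch e b t \<subseteq> S"
  unfolding seq_branch_def using assms by (intro closure_minimal span_minimal) auto

lemma rat_comb_append: "rat_comb e b t (p @ q) = rat_comb e b t p + rat_comb e b t q"
  unfolding rat_comb_def by simp

lemma rat_comb_scale:
  "rat_comb e b t (map (\<lambda>(r, j). (c * r, j)) q) = real_of_rat c *\<^sub>R rat_comb e b t q"
  unfolding rat_comb_def
  by (induction q) (auto simp: scaleR_right_distrib of_rat_mult)

lemma rat_comb_mem: "rat_comb e b t q \<in> seq_branch e b t"
proof (induction q)
  case Nil
  then show ?case by (simp add: rat_comb_def subspace_0 subspace_seq_branch)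
next
  case (Cons rj q)
  obtain r j where rj: "rj = (r, j)" by (cases rj)
  have "real_of_rat r *\<^sub>R e j (t (b j)) + rat_comb e b t q \<in> seq_branch e b t"
    by (intro subspace_add[OF subspace_seq_branch] subspace_scale[OF subspace_seq_branch]
        mem_seq_branch Cons)
  then show ?case by (simp add: rj rat_comb_def)
qed

text \<open>A list mentions finitely many generators and hence reads finitely many bits.\<close>

lemma rat_comb_local: "\<exists>N. \<forall>t. (\<forall>i<N. t i = s i) \<longrightarrow> rat_comb e b t q = rat_comb e b s q"
proof (induction q)
  case Nil
  then show ?case by (simp add: rat_comb_def)
next
  case (Cons rj q)
  obtain r j where rj: "rj = (r, j)" by (cases rj)
  obtain N where N: "\<And>t. (\<forall>i<N. t i = s i) \<Longrightarrow> rat_comb e b t q = rat_comb e b s q"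
    using Cons.IH by blast
  have "rat_comb e b t (rj # q) = rat_comb e b s (rj # q)" if "\<forall>i<max N (Suc (b j)). t i = s i" for t
  proof -
    have "rat_comb e b t q = rat_comb e b s q" "t (b j) = s (b j)" using that by (auto intro: N)
    then show ?thesis by (simp add: rj rat_comb_def)
  qed
  then show ?case by (intro exI allI impI)
qed

lemma continuous_on_rat_comb: "continuous_on UNIV (\<lambda>t. rat_comb e b t q)"
proof (induction q)
  case Nil
  then show ?case by (simp add: rat_comb_def)
next
  case (Cons rj q)
  obtain r j where rj: "rj = (r, j)" by (cases rj)
  have "continuous_on UNIV (e j \<circ> (\<lambda>t. t (b j)))"
    by (intro continuous_on_compose continuous_on_product_coordinates)
      (simp add: continuous_on_open_vimage open_discrete)
  then have "continuous_on UNIV (\<lambda>t. real_of_rat r *\<^sub>R e j (t (b j)) + rat_comb e b t q)"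
    using Cons by (intro continuous_intros) (simp_all add: o_def)
  then show ?case by (simp add: rj rat_comb_def)
qed

text \<open>Sums and rational multiples come from concatenating and scaling lists, and density of
  the rationals gives all real multiples. Thus the right-hand side is a closed subspace containing
  the generators.\<close>

lemma seq_branch_eq_closure_rat_comb: "seq_branch e b t = closure (range (rat_comb e b t))"
proof
  let ?R = "range (rat_comb e b t)"
  have cR: "rat_comb e b t q \<in> closure ?R" for q
    by (rule subsetD[OF closure_subset]) (rule rangeI)
  have add: "x + y \<in> closure ?R" if "x \<in> closure ?R" "y \<in> closure ?R" for x y
  proof -
    have "u + v \<in> closure ?R" if uv: "u \<in> ?R" "v \<in> ?R" for u v
    proof -
      obtain p q where "u = rat_comb e b t p" "v = rat_comb e b t q" using uv by blast
      then have "u + v = rat_comb e b t (p @ q)" by (simp add: rat_comb_append)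
      then show ?thesis by (simp add: cR)
    qed
    then have "(\<lambda>u. fst u + snd u) ` closure (?R \<times> ?R) \<subseteq> closure ?R"
      by (intro image_closure_subset) (auto intro!: continuous_intros)
    then show ?thesis using that unfolding closure_Times by (auto simp: image_subset_iff)
  qed
  have rat: "real_of_rat c *\<^sub>R x \<in> closure ?R" if "x \<in> closure ?R" for x c
  proof -
    have "real_of_rat c *\<^sub>R u \<in> closure ?R" if u: "u \<in> ?R" for u
    proof -
      obtain q where "u = rat_comb e b t q" using u by blast
      then have "real_of_rat c *\<^sub>R u = rat_comb e b t (map (\<lambda>(r, j). (c * r, j)) q)"
        by (simp add: rat_comb_scale)
      then show ?thesis by (simp add: cR)
    qed
    then have "(\<lambda>u. real_of_rat c *\<^sub>R u) ` closure ?R \<subseteq> closure ?R"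
      by (intro image_closure_subset) (auto intro!: continuous_intros)
    then show ?thesis using that by blast
  qed
  have scale: "c *\<^sub>R x \<in> closure ?R" if "x \<in> closure ?R" for x c
  proof -
    have "(\<lambda>c. c *\<^sub>R x) ` closure (\<rat> :: real set) \<subseteq> closure ?R"
      using rat[OF that] by (intro image_closure_subset) (auto intro!: continuous_intros elim!: Rats_cases)
    then show ?thesis by (auto simp: Rats_closure_real)
  qed
  have "0 \<in> closure ?R" using cR[of "[]"] by (simp add: rat_comb_def)
  then have "subspace (closure ?R)"
    unfolding subspace_def using add scale by simp
  moreover have "e j (t (b j)) \<in> closure ?R" for j
  proof -
    have "e j (t (b j)) = rat_comb e b t [(1, j)]" by (simp add: rat_comb_def)
    then show ?thesis by (simp add: cR)
  qed
  ultimately show "seq_branch e b t \<subseteq> closure ?R" by (intro seq_branch_minimal) auto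
  show "closure ?R \<subseteq> seq_branch e b t"
    using rat_comb_mem by (intro closure_minimal closed_seq_branch) blast
qed

lemma rat_comb_approx:
  assumes "y \<in> seq_branch e b t" "\<epsilon> > 0"
  obtains q where "norm (y - rat_comb e b t q) < \<epsilon>"
proof -
  obtain u where "u \<in> range (rat_comb e b t)" "dist u y < \<epsilon>"
    using assms unfolding seq_branch_eq_closure_rat_comb closure_approachable by blast
  then obtain q where "norm (y - rat_comb e b t q) < \<epsilon>"
    by (auto simp: dist_norm norm_minus_commute)
  then show ?thesis by (rule that)
qed

text \<open>Through \<^const>\<open>prod_decode\<close> the step \<open>k\<close> names a pair \<open>(j, m)\<close>; \<open>q\<close> is then a rational combination
  within \<open>1 / (m + 1)\<close> of the image of the \<open>j\<close>-th generator.\<close>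

definition approx_image :: "(nat \<Rightarrow> bool \<Rightarrow> 'a::real_normed_vector) \<Rightarrow> (nat \<Rightarrow> nat) \<Rightarrow> ('a \<times> 'a) set \<Rightarrow>
    (nat \<Rightarrow> bool) \<Rightarrow> (nat \<Rightarrow> bool) \<Rightarrow> nat \<Rightarrow> (rat \<times> nat) list \<Rightarrow> bool" where
  "approx_image e b \<Gamma> t s k q \<longleftrightarrow>
     (\<exists>y. (e (fst (prod_decode k)) (t (b (fst (prod_decode k)))), y) \<in> \<Gamma> \<and>
        norm (y - rat_comb e b s q) \<le> 1 / real (Suc (snd (prod_decode k))))"

text \<open>First components of \<sigma> constrain the graph and second components its converse.
  Both are recorded so that a limit graph has full domain and full range.\<close>

definition iso_scheme :: "(nat \<Rightarrow> bool \<Rightarrow> 'a::real_normed_vector) \<Rightarrow> (nat \<Rightarrow> nat) \<Rightarrow> real \<Rightarrow>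
    ((rat \<times> nat) list \<times> (rat \<times> nat) list) list \<Rightarrow> ((nat \<Rightarrow> bool) \<times> (nat \<Rightarrow> bool)) set" where
  "iso_scheme e b K \<sigma> = {(t, s). \<exists>\<Gamma>. iso_graph K \<Gamma> (seq_branch e b t) (seq_branch e b s) \<and>
     (\<forall>k<length \<sigma>. approx_image e b \<Gamma> t s k (fst (\<sigma> ! k)) \<and> approx_image e b (\<Gamma>\<inverse>) s t k (snd (\<sigma> ! k)))}"

section \<open>Limits along the branches of the scheme\<close>

lemma ex_approx_image:
  assumes "iso_graph K \<Gamma> (seq_branch e b t) (seq_branch e b s)"
  shows "\<exists>q. approx_image e b \<Gamma> t s k q"
proof -
  obtain y where y: "y \<in> seq_branch e b s" "(e (fst (prod_decode k)) (t (b (fst (prod_decode k)))), y) \<in> \<Gamma>"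
    using iso_graph_domain[OF assms mem_seq_branch] by blast
  have "1 / real (Suc (snd (prod_decode k))) > 0" by simp
  from rat_comb_approx[OF y(1) this] obtain q
    where "norm (y - rat_comb e b s q) < 1 / real (Suc (snd (prod_decode k)))" .
  from less_imp_le[OF this] show ?thesis unfolding approx_image_def using y(2) by blast
qed

text \<open>The covering condition of \<open>nonmeager_Souslin\<close>: rational combinations are
  dense in each branch, so the next approximations always exist.\<close>

lemma iso_scheme_split: "iso_scheme e b K \<sigma> \<subseteq> (\<Union>i. iso_scheme e b K (\<sigma> @ [i]))"
proof
  fix u assume "u \<in> iso_scheme e b K \<sigma>"
  then obtain t s \<Gamma> where u: "u = (t, s)" and \<Gamma>: "iso_graph K \<Gamma> (seq_branch e b t) (seq_branch e b s)"
    and k: "\<forall>k<length \<sigma>. approx_image e b \<Gamma> t s k (fst (\<sigma> ! k)) \<and> approx_image e b (\<Gamma>\<inverse>) s t k (snd (\<sigma> ! k))"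
    unfolding iso_scheme_def by blast
  obtain q q' where "approx_image e b \<Gamma> t s (length \<sigma>) q" "approx_image e b (\<Gamma>\<inverse>) s t (length \<sigma>) q'"
    using ex_approx_image[OF \<Gamma>] ex_approx_image[OF iso_graph_converse[OF \<Gamma>]] by blast
  then have "\<forall>k<length (\<sigma> @ [(q, q')]). approx_image e b \<Gamma> t s k (fst ((\<sigma> @ [(q, q')]) ! k)) \<and>
      approx_image e b (\<Gamma>\<inverse>) s t k (snd ((\<sigma> @ [(q, q')]) ! k))"
    using k by (auto simp: nth_append less_Suc_eq)
  then have "u \<in> iso_scheme e b K (\<sigma> @ [(q, q')])" using u \<Gamma> unfolding iso_scheme_def by blast
  then show "u \<in> (\<Union>i. iso_scheme e b K (\<sigma> @ [i]))" by (rule UN_I[OF UNIV_I])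
qed

text \<open>Once \<open>n\<close> exceeds the coordinates involved, neither the \<open>j\<close>-th
  generator nor the combination prescribed at step \<open>(j, m)\<close> depends on \<open>n\<close>
  any more. These fixed vectors \<open>v m\<close> are the input of
  \<open>graph_liminf_exists_image\<close>.\<close>

lemma approx_image_limit:
  fixes e :: "nat \<Rightarrow> bool \<Rightarrow> 'a::banach"
  assumes \<Gamma>: "\<And>n. iso_graph K (\<Gamma> n) (seq_branch e b (t' n)) (seq_branch e b (s' n))"
    and ts: "\<And>n i. i < n \<Longrightarrow> t' n i = t i \<and> s' n i = s i"
    and q: "\<And>k n. k < n \<Longrightarrow> approx_image e b (\<Gamma> n) (t' n) (s' n) k (q k)"
  shows "\<exists>y. (e j (t (b j)), y) \<in> graph_liminf \<Gamma> \<and> y \<in> seq_branch e b s \<and>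
    (\<forall>k. fst (prod_decode k) = j \<longrightarrow>
      norm (y - rat_comb e b s (q k)) \<le> 1 / real (Suc (snd (prod_decode k))))"
proof -
  define v where "v m = rat_comb e b s (q (prod_encode (j, m)))" for m
  have "\<exists>N. \<forall>n\<ge>N. \<exists>y. (e j (t (b j)), y) \<in> \<Gamma> n \<and> norm (y - v m) \<le> 1 / real (Suc m)" for m
  proof -
    let ?k = "prod_encode (j, m)"
    obtain N where N: "\<And>t. (\<forall>i<N. t i = s i) \<Longrightarrow> rat_comb e b t (q ?k) = v m"
      using rat_comb_local[of s e b "q ?k"] unfolding v_def by blast
    have "\<exists>y. (e j (t (b j)), y) \<in> \<Gamma> n \<and> norm (y - v m) \<le> 1 / real (Suc m)"
      if n: "n \<ge> max N (max (Suc ?k) (Suc (b j)))" for n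
    proof -
      have "rat_comb e b (s' n) (q ?k) = v m" using n ts by (intro N) auto
      moreover have "t' n (b j) = t (b j)" using n ts[of "b j" n] by auto
      moreover have "approx_image e b (\<Gamma> n) (t' n) (s' n) ?k (q ?k)" using n by (intro q) auto
      ultimately show ?thesis unfolding approx_image_def by simp
    qed
    then show ?thesis by blast
  qed
  from graph_liminf_exists_image[OF \<Gamma> this]
  obtain y where y: "(e j (t (b j)), y) \<in> graph_liminf \<Gamma>" "v \<longlonglongrightarrow> y"
    "\<And>m. norm (y - v m) \<le> 1 / real (Suc m)" by blast
  have "v m \<in> seq_branch e b s" for m unfolding v_def by (rule rat_comb_mem)
  then have "y \<in> seq_branch e b s" by (rule closed_sequentially[OF closed_seq_branch _ y(2)])
  moreover have "norm (y - rat_comb e b s (q k)) \<le> 1 / real (Suc (snd (prod_decode k)))"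
    if "fst (prod_decode k) = j" for k
  proof -
    have "prod_encode (j, snd (prod_decode k)) = k" unfolding that[symmetric] by simp
    then show ?thesis using y(3)[of "snd (prod_decode k)"] unfolding v_def by simp
  qed
  ultimately show ?thesis using y(1) by (intro exI[of _ y]) simp
qed

text \<open>The limit graph is closed and keeps the bound \<open>K\<close>, so its domain is a
  closed subspace; containing the generators, it is the whole branch. The range is handled as the
  domain of the converse.\<close>

lemma iso_graph_liminf:
  fixes e :: "nat \<Rightarrow> bool \<Rightarrow> 'a::banach"
  assumes "0 \<le> K" and \<Gamma>: "\<And>n. iso_graph K (\<Gamma> n) (F n) (G n)"
    and t: "\<And>j. \<exists>y\<in>seq_branch e b s. (e j (t (b j)), y) \<in> graph_liminf \<Gamma>"
    and s: "\<And>j. \<exists>x\<in>seq_branch e b t. (x, e j (s (b j))) \<in> graph_liminf \<Gamma>"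
  shows "iso_graph K (graph_liminf \<Gamma> \<inter> seq_branch e b t \<times> seq_branch e b s)
    (seq_branch e b t) (seq_branch e b s)"
proof -
  have dom: "fst ` (graph_liminf \<Gamma> \<inter> seq_branch e b t \<times> seq_branch e b s) = seq_branch e b t"
    if \<Gamma>: "\<And>n. iso_graph K (\<Gamma> n) (F n) (G n)"
      and t: "\<And>j. \<exists>y\<in>seq_branch e b s. (e j (t (b j)), y) \<in> graph_liminf \<Gamma>" for \<Gamma> F G t s
  proof
    let ?\<Gamma> = "graph_liminf \<Gamma> \<inter> seq_branch e b t \<times> seq_branch e b s"
    have sub: "subspace ?\<Gamma>"
      using \<Gamma> by (intro subspace_inter subspace_graph_liminf subspace_Times subspace_seq_branch)
        (auto simp: iso_graph_def)
    have "closed (fst ` ?\<Gamma>)"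
    proof (rule closed_fst_image_bounded_graph[OF sub _ assms(1)])
      show "closed ?\<Gamma>" by (intro closed_Int closed_graph_liminf closed_Times closed_seq_branch)
      show "norm y \<le> K * norm x" if "(x, y) \<in> ?\<Gamma>" for x y
        using graph_liminf_norm[of \<Gamma> K x y] iso_graph_norm(1)[OF \<Gamma>] assms(1) that by blast
    qed
    moreover have "subspace (fst ` ?\<Gamma>)"
      using sub by (intro linear_subspace_image) (auto intro: bounded_linear.linear bounded_linear_fst)
    moreover have "e j (t (b j)) \<in> fst ` ?\<Gamma>" for j
      using t[of j] mem_seq_branch[of e j t b] by force
    ultimately show "seq_branch e b t \<subseteq> fst ` ?\<Gamma>" by (rule seq_branch_minimal)
  qed auto
  have "snd ` (graph_liminf \<Gamma> \<inter> seq_branch e b t \<times> seq_branch e b s) =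
      fst ` (graph_liminf (\<lambda>n. (\<Gamma> n)\<inverse>) \<inter> seq_branch e b s \<times> seq_branch e b t)"
    by (force simp: graph_liminf_converse)
  also have "\<dots> = seq_branch e b s"
    by (rule dom[OF iso_graph_converse[OF \<Gamma>]]) (use s in \<open>simp add: graph_liminf_converse\<close>)
  finally have rng: "snd ` (graph_liminf \<Gamma> \<inter> seq_branch e b t \<times> seq_branch e b s) = seq_branch e b s" .
  have "subspace (graph_liminf \<Gamma> \<inter> seq_branch e b t \<times> seq_branch e b s)"
    using \<Gamma> by (intro subspace_inter subspace_graph_liminf subspace_Times subspace_seq_branch)
      (auto simp: iso_graph_def)
  moreover have "norm y \<le> K * norm x \<and> norm x \<le> K * norm y" if "(x, y) \<in> graph_liminf \<Gamma>" for x y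
  proof
    show "norm y \<le> K * norm x"
      using graph_liminf_norm[of \<Gamma> K x y] iso_graph_norm(1)[OF \<Gamma>] assms(1) that by blast
    have "(y, x) \<in> graph_liminf (\<lambda>n. (\<Gamma> n)\<inverse>)" using that by (simp add: graph_liminf_converse)
    then show "norm x \<le> K * norm y"
      using graph_liminf_norm[of "\<lambda>n. (\<Gamma> n)\<inverse>" K y x] iso_graph_norm(2)[OF \<Gamma>] assms(1) by blast
  qed
  ultimately show ?thesis unfolding iso_graph_def using dom[OF \<Gamma> t] rng by blast
qed

text \<open>The \<open>n\<close>-th closure supplies a graph \<open>\<Gamma> n\<close> for a pair
  that agrees with \<open>(t, s)\<close> below \<open>n\<close>, subject to the first
  \<open>n\<close> entries of one common infinite list. Hence the images of the generators converge,
  and the lower limit inherits both \<open>K\<close> and the constraints in \<sigma>.\<close>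

lemma iso_scheme_closed_branch:
  fixes e :: "nat \<Rightarrow> bool \<Rightarrow> 'a::banach"
  assumes "0 \<le> K" and cl: "\<And>n. (t, s) \<in> closure (iso_scheme e b K (\<sigma> @ map \<tau> [0..<n]))"
  shows "(t, s) \<in> iso_scheme e b K \<sigma>"
proof -
  \<comment> \<open>The \<open>k\<close>-th entry of \<sigma> continued by \<tau>; taking
    \<open>Suc k\<close> terms of \<tau> keeps the index in range.\<close>
  define \<rho> where "\<rho> k = (\<sigma> @ map \<tau> [0..<Suc k]) ! k" for k
  have \<rho>: "(\<sigma> @ map \<tau> [0..<n]) ! k = \<rho> k" if "k < length \<sigma> + n" for k n
    using that by (auto simp: \<rho>_def nth_append simp del: upt_Suc)
  have "\<exists>t' s' \<Gamma>. (\<forall>i<n. t' i = t i \<and> s' i = s i) \<and>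
      iso_graph K \<Gamma> (seq_branch e b t') (seq_branch e b s') \<and>
      (\<forall>k<n. approx_image e b \<Gamma> t' s' k (fst (\<rho> k)) \<and> approx_image e b (\<Gamma>\<inverse>) s' t' k (snd (\<rho> k)))" for n
  proof -
    define W where "W = {t'. \<forall>i<n. t' i = t i} \<times> {s'. \<forall>i<n. s' i = s i}"
    have "open W" unfolding W_def by (intro open_Times open_agree)
    then have "W \<inter> iso_scheme e b K (\<sigma> @ map \<tau> [0..<n]) \<noteq> {}"
      using open_Int_closure_eq_empty[of W "iso_scheme e b K (\<sigma> @ map \<tau> [0..<n])"] cl[of n]
      unfolding W_def by (auto simp del: mem_Sigma_iff intro: SigmaI)
    then obtain t' s' where W: "(t', s') \<in> W" and "(t', s') \<in> iso_scheme e b K (\<sigma> @ map \<tau> [0..<n])"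
      by auto
    then obtain \<Gamma> where \<Gamma>: "iso_graph K \<Gamma> (seq_branch e b t') (seq_branch e b s')"
      and k: "\<forall>k<length (\<sigma> @ map \<tau> [0..<n]).
        approx_image e b \<Gamma> t' s' k (fst ((\<sigma> @ map \<tau> [0..<n]) ! k)) \<and>
        approx_image e b (\<Gamma>\<inverse>) s' t' k (snd ((\<sigma> @ map \<tau> [0..<n]) ! k))"
      unfolding iso_scheme_def by blast
    have "\<forall>k<n. approx_image e b \<Gamma> t' s' k (fst (\<rho> k)) \<and> approx_image e b (\<Gamma>\<inverse>) s' t' k (snd (\<rho> k))"
      using k \<rho>[of _ n] by simp
    moreover have "\<forall>i<n. t' i = t i \<and> s' i = s i" using W unfolding W_def by simp
    ultimately show ?thesis using \<Gamma> by (intro exI conjI)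
  qed
  then obtain t' s' \<Gamma> where ts: "\<And>n i. i < n \<Longrightarrow> t' n i = t i \<and> s' n i = s i"
    and \<Gamma>: "\<And>n. iso_graph K (\<Gamma> n) (seq_branch e b (t' n)) (seq_branch e b (s' n))"
    and a: "\<And>k n. k < n \<Longrightarrow> approx_image e b (\<Gamma> n) (t' n) (s' n) k (fst (\<rho> k))"
      "\<And>k n. k < n \<Longrightarrow> approx_image e b ((\<Gamma> n)\<inverse>) (s' n) (t' n) k (snd (\<rho> k))"
    by metis
  let ?\<Gamma> = "graph_liminf \<Gamma> \<inter> seq_branch e b t \<times> seq_branch e b s"
  have st: "\<And>n i. i < n \<Longrightarrow> s' n i = s i \<and> t' n i = t i" using ts by blast
  have 1: "\<exists>y. (e j (t (b j)), y) \<in> graph_liminf \<Gamma> \<and> y \<in> seq_branch e b s \<and>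
      (\<forall>k. fst (prod_decode k) = j \<longrightarrow>
        norm (y - rat_comb e b s (fst (\<rho> k))) \<le> 1 / real (Suc (snd (prod_decode k))))" for j
    by (rule approx_image_limit[where j = j, OF \<Gamma> ts a(1)]) assumption+
  have "\<exists>x. (e j (s (b j)), x) \<in> graph_liminf (\<lambda>n. (\<Gamma> n)\<inverse>) \<and> x \<in> seq_branch e b t \<and>
      (\<forall>k. fst (prod_decode k) = j \<longrightarrow>
        norm (x - rat_comb e b t (snd (\<rho> k))) \<le> 1 / real (Suc (snd (prod_decode k))))" for j
    by (rule approx_image_limit[where j = j, OF iso_graph_converse[OF \<Gamma>] st a(2)]) assumption+
  note 2 = this[unfolded graph_liminf_converse]
  have "iso_graph K ?\<Gamma> (seq_branch e b t) (seq_branch e b s)"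
    by (rule iso_graph_liminf[OF assms(1) \<Gamma>]) (use 1 2 in blast)+
  moreover have "approx_image e b ?\<Gamma> t s k (fst (\<rho> k))" for k
    using 1[of "fst (prod_decode k)"] mem_seq_branch[of e _ t b] unfolding approx_image_def by blast
  moreover have "approx_image e b (?\<Gamma>\<inverse>) s t k (snd (\<rho> k))" for k
    using 2[of "fst (prod_decode k)"] mem_seq_branch[of e _ s b] unfolding approx_image_def by blast
  moreover have "\<sigma> ! k = \<rho> k" if "k < length \<sigma>" for k using \<rho>[of k 0] that by simp
  ultimately show ?thesis unfolding iso_scheme_def by auto
qed

text \<open>The length \<open>L n\<close> may vary with the constant \<open>n\<close>, because the
  block and the precision that control the sections depend on the isomorphism constant.\<close>

lemma isomorphic_seq_branch_subset_scheme:
  fixes e :: "nat \<Rightarrow> bool \<Rightarrow> 'a::banach"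
  shows "{(t, s). isomorphic_subspaces (seq_branch e b t) (seq_branch e b s)} \<subseteq>
     (\<Union>n::nat. \<Union>\<sigma>\<in>{\<sigma>. length \<sigma> = L n}. iso_scheme e b (real n) \<sigma>)"
proof clarify
  fix t s assume "isomorphic_subspaces (seq_branch e b t) (seq_branch e b s)"
  then obtain n :: nat and \<Gamma> where "iso_graph (real n) \<Gamma> (seq_branch e b t) (seq_branch e b s)"
    using isomorphic_subspaces_iff_iso_graph[OF subspace_seq_branch] by blast
  then have "(t, s) \<in> iso_scheme e b (real n) []" unfolding iso_scheme_def by auto
  moreover have "iso_scheme e b (real n) [] \<subseteq> (\<Union>\<sigma>\<in>{\<sigma>. length \<sigma> = l}. iso_scheme e b (real n) \<sigma>)" for l
  proof (induction l)
    case (Suc l)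
    have "iso_scheme e b (real n) \<sigma> \<subseteq> (\<Union>\<sigma>\<in>{\<sigma>. length \<sigma> = Suc l}. iso_scheme e b (real n) \<sigma>)"
      if "length \<sigma> = l" for \<sigma>
      using iso_scheme_split[of e b "real n" \<sigma>] that by force
    then show ?case using Suc by blast
  qed simp
  ultimately have "(t, s) \<in> (\<Union>\<sigma>\<in>{\<sigma>. length \<sigma> = L n}. iso_scheme e b (real n) \<sigma>)"
    by (rule subsetD[rotated])
  then show "(t, s) \<in> (\<Union>n::nat. \<Union>\<sigma>\<in>{\<sigma>. length \<sigma> = L n}. iso_scheme e b (real n) \<sigma>)"
    by (rule UN_I[OF UNIV_I])
qed

text \<open>Otherwise almost every point of some nonempty open set lies in all closures along a
  branch, and \<open>iso_scheme_closed_branch\<close> returns such points to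
  \<open>iso_scheme e b K \<sigma>\<close> itself. Two inequivalent points of one section then
  contradict \<open>fib\<close>.\<close>

lemma meager_iso_scheme:
  fixes e :: "nat \<Rightarrow> bool \<Rightarrow> 'a::banach"
  assumes "0 \<le> K"
    and fib: "\<And>t t' s. (t, s) \<in> iso_scheme e b K \<sigma> \<Longrightarrow> (t', s) \<in> iso_scheme e b K \<sigma> \<Longrightarrow> t n = t' n \<Longrightarrow> E0 t t'"
  shows "meager (iso_scheme e b K \<sigma>)"
proof (rule ccontr)
  assume "\<not> meager (iso_scheme e b K \<sigma>)"
  define B where "B = {x. \<exists>\<tau>. \<forall>n. x \<in> closure (iso_scheme e b K (\<sigma> @ map \<tau> [0..<n]))}"
  obtain V where V: "open V" "V \<noteq> {}" "meager (V - B)"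
    unfolding B_def
    by (rule nonmeager_Souslin[OF iso_scheme_split \<open>\<not> meager (iso_scheme e b K \<sigma>)\<close>])
  obtain t t' s where *: "(t, s) \<in> B" "(t', s) \<in> B" "t n = t' n" "\<not> E0 t t'"
    by (rule comeager_two_points_in_section[OF V])
  have B: "u \<in> iso_scheme e b K \<sigma>" if "u \<in> B" for u
  proof -
    obtain t s \<tau> where u: "u = (t, s)"
      and \<tau>: "\<And>n. (t, s) \<in> closure (iso_scheme e b K (\<sigma> @ map \<tau> [0..<n]))"
      using \<open>u \<in> B\<close> unfolding B_def by (cases u) auto
    from \<tau> show ?thesis unfolding u by (rule iso_scheme_closed_branch[OF assms(1)])
  qed
  show False using fib[OF B[OF *(1)] B[OF *(2)] *(3)] *(4) by simp
qed

section \<open>Block traces and the reduction\<close>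

text \<open>Block 1 starts at 2, so the generators are renumbered from 0 through the shift
  \<open>j + 2\<close>; the value is the number of the block containing
  \<open>j + 2\<close>.\<close>

definition block_index :: "nat \<Rightarrow> nat" where
  "block_index j = (LEAST n. j + 2 < 2 ^ (n + 1))"

lemma mem_dyadic_block_iff: "j + 2 \<in> dyadic_block n \<longleftrightarrow> block_index j = n"
proof
  assume n: "j + 2 \<in> dyadic_block n"
  show "block_index j = n"
    unfolding block_index_def
  proof (rule Least_equality)
    show "j + 2 < 2 ^ (n + 1)" using n unfolding dyadic_block_def by simp
    fix m assume "j + 2 < 2 ^ (m + 1)"
    then have "(2::nat) ^ n < 2 ^ (m + 1)" using n unfolding dyadic_block_def by simp
    then have "n < m + 1" by (rule power_less_imp_less_exp[rotated]) simp
    then show "n \<le> m" by simp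
  qed
next
  assume n: "block_index j = n"
  have "j + 2 < 2 ^ (j + 2 + 1)" using less_exp[of "j + 2"] by simp
  then have up: "j + 2 < 2 ^ (n + 1)"
    unfolding n[symmetric] block_index_def by (rule LeastI)
  have "2 ^ n \<le> j + 2"
  proof (cases n)
    case (Suc m)
    then have "\<not> j + 2 < 2 ^ (m + 1)"
      using not_less_Least[of m "\<lambda>n. j + 2 < 2 ^ (n + 1)"] n unfolding block_index_def by simp
    then show ?thesis by (simp add: Suc)
  qed simp
  with up show "j + 2 \<in> dyadic_block n" unfolding dyadic_block_def by simp
qed

lemma block_index_ge_1: "block_index j \<ge> 1"
proof (rule ccontr)
  assume "\<not> block_index j \<ge> 1"
  then have "block_index j = 0" by simp
  then have "j + 2 \<in> dyadic_block 0" using mem_dyadic_block_iff by blast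
  then show False by (simp add: dyadic_block_def)
qed

lemma dyadic_block_ge_2: "n \<ge> 1 \<Longrightarrow> j \<in> dyadic_block n \<Longrightarrow> j \<ge> 2"
  using power_increasing[of 1 n "2::nat"] unfolding dyadic_block_def by simp

lemma dyadic_block_unique: "n \<ge> 1 \<Longrightarrow> j \<in> dyadic_block n \<Longrightarrow> j \<in> dyadic_block m \<Longrightarrow> n = m"
  by (metis dyadic_block_ge_2 le_add_diff_inverse2 mem_dyadic_block_iff)

lemma finite_block_index_less: "finite {j. block_index j < N}"
proof (rule finite_subset)
  show "{j. block_index j < N} \<subseteq> {..<2 ^ (N + 1)}"
  proof
    fix j assume "j \<in> {j. block_index j < N}"
    then have "(2::nat) ^ (block_index j + 1) \<le> 2 ^ (N + 1)"
      by (intro power_increasing) auto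
    moreover have "j + 2 < 2 ^ (block_index j + 1)"
      using mem_dyadic_block_iff[of j "block_index j"] unfolding dyadic_block_def by simp
    ultimately have "j + 2 < 2 ^ (N + 1)" by linarith
    then show "j \<in> {..<2 ^ (N + 1)}" by simp
  qed
qed simp

lemma branch_space_eq_seq_branch: "branch_space z t = seq_branch (\<lambda>j. z (j + 2)) block_index t"
proof -
  have "{z j (t n) |j n. n \<ge> 1 \<and> j \<in> dyadic_block n} = range (\<lambda>j. z (j + 2) (t (block_index j)))"
  proof (intro set_eqI iffI)
    fix x assume "x \<in> {z j (t n) |j n. n \<ge> 1 \<and> j \<in> dyadic_block n}"
    then obtain j n where x: "x = z j (t n)" "n \<ge> 1" "j \<in> dyadic_block n" by blast
    have j: "j = (j - 2) + 2" using dyadic_block_ge_2[OF x(2,3)] by simp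
    have "block_index (j - 2) = n" using x(3) unfolding mem_dyadic_block_iff[symmetric] j[symmetric] .
    then have "x = z ((j - 2) + 2) (t (block_index (j - 2)))" using x(1) j by simp
    then show "x \<in> range (\<lambda>j. z (j + 2) (t (block_index j)))" by (rule range_eqI)
  next
    fix x assume "x \<in> range (\<lambda>j. z (j + 2) (t (block_index j)))"
    then obtain j where x: "x = z (j + 2) (t (block_index j))" by blast
    have "block_index j \<ge> 1" "j + 2 \<in> dyadic_block (block_index j)"
      using block_index_ge_1 mem_dyadic_block_iff by blast+
    then show "x \<in> {z j (t n) |j n. n \<ge> 1 \<and> j \<in> dyadic_block n}" using x by blast
  qed
  then show ?thesis unfolding branch_space_def seq_branch_def by simp
qed

lemma mem_branch_space: "n \<ge> 1 \<Longrightarrow> j \<in> dyadic_block n \<Longrightarrow> z j (t n) \<in> branch_space z t"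
  unfolding branch_space_def by (rule subsetD[OF closure_subset], rule span_base) blast

text \<open>The operator \<open>T t s\<close> is the identity plus a finite-rank correction that, by
  biorthogonality, replaces the generators selected by \<open>t\<close> with those selected by
  \<open>s\<close>; its inverse is \<open>T s t\<close>. Each claim is checked on generators and
  holds on a closed subspace.\<close>

lemma E0_imp_isomorphic:
  fixes e :: "nat \<Rightarrow> bool \<Rightarrow> 'a::real_normed_vector" and e' :: "nat \<Rightarrow> bool \<Rightarrow> 'a \<Rightarrow>\<^sub>L real"
  assumes e: "\<And>i j \<epsilon> \<tau>. blinfun_apply (e' i \<epsilon>) (e j \<tau>) = (if i = j \<and> \<epsilon> = \<tau> then 1 else 0)"
    and fin: "\<And>N. finite {j. b j < N}" and "E0 t s"
  shows "isomorphic_subspaces (seq_branch e b t) (seq_branch e b s)"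
proof -
  obtain N where N: "\<forall>n\<ge>N. t n = s n" using assms(3) unfolding E0_def by blast
  define T where "T t s x = x + (\<Sum>j\<in>{j. b j < N}. blinfun_apply (e' j (t (b j))) x *\<^sub>R
    (e j (s (b j)) - e j (t (b j))))" for t s and x :: 'a
  have bl: "bounded_linear (T t s)" for t s
    unfolding T_def
    by (intro bounded_linear_add bounded_linear_ident bounded_linear_sum bounded_linear_scaleR_const
        blinfun.bounded_linear_right)
  have Te: "T t s (e i (t (b i))) = e i (s (b i))" if st: "\<forall>n\<ge>N. t n = s n" for t s i
  proof -
    have "(\<Sum>j\<in>{j. b j < N}. blinfun_apply (e' j (t (b j))) (e i (t (b i))) *\<^sub>R
        (e j (s (b j)) - e j (t (b j)))) =
      (\<Sum>j\<in>{j. b j < N}. if j = i then e i (s (b i)) - e i (t (b i)) else 0)"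
      by (intro sum.cong) (auto simp: e)
    also have "\<dots> = (if b i < N then e i (s (b i)) - e i (t (b i)) else 0)"
      using fin by (simp add: sum.delta)
    \<comment> \<open>If \<open>b i \<ge> N\<close>, both sequences select the same generator and
      the difference is 0.\<close>
    also have "\<dots> = e i (s (b i)) - e i (t (b i))" using st by auto
    finally show ?thesis unfolding T_def by simp
  qed
  have im: "T t s x \<in> seq_branch e b s" if st: "\<forall>n\<ge>N. t n = s n" and x: "x \<in> seq_branch e b t" for t s x
  proof -
    have "seq_branch e b t \<subseteq> T t s -` seq_branch e b s"
    proof (rule seq_branch_minimal)
      show "closed (T t s -` seq_branch e b s)"
        using bl by (intro closed_vimage closed_seq_branch) (rule linear_continuous_on)
      show "subspace (T t s -` seq_branch e b s)"
        by (intro linear_subspace_vimage bounded_linear.linear bl subspace_seq_branch)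
      show "e j (t (b j)) \<in> T t s -` seq_branch e b s" for j
        using mem_seq_branch by (simp add: Te[OF st])
    qed
    then show ?thesis using x by blast
  qed
  have bo: "bounded_linear_on (seq_branch e b t) (seq_branch e b s) (T t s)"
    if st: "\<forall>n\<ge>N. t n = s n" for t s
    unfolding bounded_linear_on_def
    using im[OF st] bounded_linear.bounded[OF bl[of t s]] linear_simps(1,5)[OF bl[of t s]] by blast
  have inv: "T s t (T t s x) = x" if st: "\<forall>n\<ge>N. t n = s n" and x: "x \<in> seq_branch e b t" for t s x
  proof -
    have l: "bounded_linear (\<lambda>x. T s t (T t s x) - x)"
      by (intro bounded_linear_sub bounded_linear_compose[OF bl bl] bounded_linear_ident)
    have "seq_branch e b t \<subseteq> (\<lambda>x. T s t (T t s x) - x) -` {0}"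
    proof (rule seq_branch_minimal)
      show "closed ((\<lambda>x. T s t (T t s x) - x) -` {0})"
        using l by (intro closed_vimage) (auto intro: linear_continuous_on)
      show "subspace ((\<lambda>x. T s t (T t s x) - x) -` {0})"
        by (intro linear_subspace_vimage bounded_linear.linear l subspace_single_0)
      have "\<forall>n\<ge>N. s n = t n" using st by auto
      then show "e j (t (b j)) \<in> (\<lambda>x. T s t (T t s x) - x) -` {0}" for j
        using Te[OF st] Te[of s t] by simp
    qed
    then show ?thesis using x by auto
  qed
  have N': "\<forall>n\<ge>N. s n = t n" using N by auto
  show ?thesis
    unfolding isomorphic_subspaces_def
    by (intro exI[of _ "T t s"] exI[of _ "T s t"] conjI bo N N' ballI inv)
qed

text \<open>The biorthogonal functionals make the generators an infinite independent family, which
  fits into no finite span.\<close>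

lemma seq_branch_in_SB:
  fixes e :: "nat \<Rightarrow> bool \<Rightarrow> 'a::real_normed_vector" and e' :: "nat \<Rightarrow> bool \<Rightarrow> 'a \<Rightarrow>\<^sub>L real"
  assumes e: "\<And>i j \<epsilon> \<tau>. blinfun_apply (e' i \<epsilon>) (e j \<tau>) = (if i = j \<and> \<epsilon> = \<tau> then 1 else 0)"
  shows "seq_branch e b t \<in> SB"
proof -
  define w where "w j = e j (t (b j))" for j
  have w: "blinfun_apply (e' i (t (b i))) (w j) = (if i = j then 1 else 0)" for i j
    by (simp add: w_def e)
  have "inj w"
  proof (rule injI)
    fix i j assume "w i = w j"
    then show "i = j" using w[of i i] w[of i j] by (simp split: if_splits)
  qed
  have ind: "independent (range w)"
    unfolding dependent_def
  proof
    assume "\<exists>a\<in>range w. a \<in> span (range w - {a})"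
    then obtain i where i: "w i \<in> span (range w - {w i})" by blast
    have "span (range w - {w i}) \<subseteq> blinfun_apply (e' i (t (b i))) -` {0}"
    proof (rule span_minimal)
      show "range w - {w i} \<subseteq> blinfun_apply (e' i (t (b i))) -` {0}" by (auto simp: w)
      show "subspace (blinfun_apply (e' i (t (b i))) -` {0})"
        by (intro linear_subspace_vimage bounded_linear.linear blinfun.bounded_linear_right subspace_single_0)
    qed
    then show False using i w[of i i] by auto
  qed
  have "seq_branch e b t \<noteq> span B" if B: "finite B" for B
  proof
    assume "seq_branch e b t = span B"
    then have "range w \<subseteq> span B" using mem_seq_branch[of e _ t b] unfolding w_def by auto
    then have "finite (range w)" using independent_span_bound[OF B ind] by blast
    then show False using \<open>inj w\<close> finite_imageD infinite_UNIV_nat by blast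
  qed
  then show ?thesis unfolding SB_def using closed_seq_branch subspace_seq_branch by blast
qed

text \<open>A branch meets an open \<open>U\<close> iff some rational combination lies in
  \<open>U\<close>. This is an open condition on \<open>x\<close>, so the generators of the Effros
  structure have open preimages.\<close>

lemma measurable_seq_branch:
  fixes e :: "nat \<Rightarrow> bool \<Rightarrow> 'a::real_normed_vector"
  assumes f: "continuous_on UNIV f" and SB: "\<And>t. seq_branch e b t \<in> SB"
  shows "(\<lambda>x. seq_branch e b (f x)) \<in> borel \<rightarrow>\<^sub>M restrict_space effros SB"
proof (rule measurable_restrict_space2)
  show "(\<lambda>x. seq_branch e b (f x)) \<in> space borel \<rightarrow> SB" using SB by blast
  show "(\<lambda>x. seq_branch e b (f x)) \<in> borel \<rightarrow>\<^sub>M effros"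
    unfolding effros_def
  proof (rule measurable_measure_of)
    show "{{F. closed F \<and> F \<inter> U \<noteq> {}} |U::'a set. open U} \<subseteq> Pow {F. closed F}" by blast
    show "(\<lambda>x. seq_branch e b (f x)) \<in> space borel \<rightarrow> {F. closed F}" using closed_seq_branch by blast
    fix A :: "'a set set" assume "A \<in> {{F. closed F \<and> F \<inter> U \<noteq> {}} |U. open U}"
    then obtain U where A: "A = {F. closed F \<and> F \<inter> U \<noteq> {}}" and U: "open U" by blast
    have "seq_branch e b t \<inter> U \<noteq> {} \<longleftrightarrow> (\<exists>q. rat_comb e b t q \<in> U)" for t
      using open_Int_closure_eq_empty[OF U, of "range (rat_comb e b t)"]
      unfolding seq_branch_eq_closure_rat_comb by blast
    then have "(\<lambda>x. seq_branch e b (f x)) -` A = (\<Union>q. (\<lambda>x. rat_comb e b (f x) q) -` U)"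
      unfolding A using closed_seq_branch by auto
    moreover have "open ((\<lambda>x. rat_comb e b (f x) q) -` U)" for q
      using continuous_on_compose2[OF continuous_on_rat_comb f] by (intro open_vimage[OF U]) auto
    ultimately have "open ((\<lambda>x. seq_branch e b (f x)) -` A)" by auto
    then show "(\<lambda>x. seq_branch e b (f x)) -` A \<inter> space borel \<in> sets borel" by simp
  qed
qed

section \<open>Estimates for block traces\<close>

lemma onorm_on_bounds:
  assumes "0 \<in> F" "0 \<le> K" "\<And>x. x \<in> F \<Longrightarrow> norm (T x) \<le> K * norm x"
  shows "0 \<le> onorm_on F T" "onorm_on F T \<le> K"
proof -
  have le: "norm (T x) / norm x \<le> K" if "x \<in> F" for x
    using assms(2) assms(3)[OF that] by (cases "x = 0") (auto simp: divide_le_eq)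
  show "onorm_on F T \<le> K" unfolding onorm_on_def using assms(1) le by (intro cSUP_least) auto
  have "bdd_above ((\<lambda>x. norm (T x) / norm x) ` F)" using le by (auto intro!: bdd_aboveI)
  \<comment> \<open>The quotient at the point 0 is 0, since division by zero yields 0.\<close>
  from cSUP_upper[OF assms(1) this] show "0 \<le> onorm_on F T" unfolding onorm_on_def by simp
qed

text \<open>Among the generators of \<open>branch_space z s\<close>, the one with index
  \<open>j\<close> carries the bit \<open>s n\<close>, so \<open>z' j (t n)\<close> annihilates all
  of them and, by continuity, the whole space.\<close>

lemma block_trace_eq_0:
  fixes z :: "nat \<Rightarrow> bool \<Rightarrow> 'a::real_normed_vector"
  assumes z: "\<And>i j \<epsilon> \<tau>. i \<ge> 1 \<Longrightarrow> j \<ge> 1 \<Longrightarrow>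
      blinfun_apply (z' i \<epsilon>) (z j \<tau>) = (if i = j \<and> \<epsilon> = \<tau> then 1 else 0)"
    and "n \<ge> 1" "t n \<noteq> s n" and T: "\<And>j. j \<in> dyadic_block n \<Longrightarrow> T (z j (t n)) \<in> branch_space z s"
  shows "block_trace z z' n t T = 0"
proof -
  have "blinfun_apply (z' j (t n)) (T (z j (t n))) = 0" if j: "j \<in> dyadic_block n" for j
  proof -
    have "branch_space z s \<subseteq> blinfun_apply (z' j (t n)) -` {0}"
      unfolding branch_space_def
    proof (intro closure_minimal span_minimal)
      show "closed (blinfun_apply (z' j (t n)) -` {0})"
        by (intro closed_vimage linear_continuous_on blinfun.bounded_linear_right) simp
      show "subspace (blinfun_apply (z' j (t n)) -` {0})"
        by (intro linear_subspace_vimage bounded_linear.linear blinfun.bounded_linear_right subspace_single_0)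
      show "{z i (s m) |i m. m \<ge> 1 \<and> i \<in> dyadic_block m} \<subseteq> blinfun_apply (z' j (t n)) -` {0}"
      proof
        fix x assume "x \<in> {z i (s m) |i m. m \<ge> 1 \<and> i \<in> dyadic_block m}"
        then obtain i m where x: "x = z i (s m)" "m \<ge> 1" "i \<in> dyadic_block m" by blast
        have "i \<ge> 1" "j \<ge> 1" using dyadic_block_ge_2[OF x(2,3)] dyadic_block_ge_2[OF assms(2) j] by auto
        moreover have "\<not> (j = i \<and> t n = s m)"
          using dyadic_block_unique[OF assms(2) j] x(3) assms(3) by blast
        ultimately show "x \<in> blinfun_apply (z' j (t n)) -` {0}" unfolding x(1) by (auto simp: z)
      qed
    qed
    then show ?thesis using T[OF j] by auto
  qed
  then show ?thesis unfolding block_trace_def by simp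
qed

text \<open>Let \<open>R\<close> have the graph \<open>\<Gamma>' O \<Gamma>\<inverse>\<close>.
  Closeness on block \<open>n\<close> makes its trace there at least 3/4, the tail of \<alpha>
  allows a later change of at most 1/4, and the trace is 0 at any later block where \<open>t\<close>
  and \<open>t'\<close> differ. Both \<open>n\<close> and \<delta> are chosen before the
  branches.\<close>

lemma E0_of_common_image:
  fixes z :: "nat \<Rightarrow> bool \<Rightarrow> 'a::real_normed_vector"
  assumes M: "\<And>j \<epsilon>. j \<ge> 1 \<Longrightarrow> norm (z' j \<epsilon>) \<le> M"
    and z: "\<And>i j \<epsilon> \<tau>. i \<ge> 1 \<Longrightarrow> j \<ge> 1 \<Longrightarrow>
      blinfun_apply (z' i \<epsilon>) (z j \<tau>) = (if i = j \<and> \<epsilon> = \<tau> then 1 else 0)"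
    and tr: "\<And>t s T n. bounded_linear_on (branch_space z t) (branch_space z s) T \<Longrightarrow> n \<ge> 2 \<Longrightarrow>
      \<bar>block_trace z z' n t T - block_trace z z' (n - 1) t T\<bar> \<le> \<alpha> n * onorm_on (branch_space z t) T"
    and "summable \<alpha>" "0 \<le> K"
  shows "\<exists>n\<ge>1. \<exists>\<delta>>0. \<forall>t t' s \<Gamma> \<Gamma>'. iso_graph K \<Gamma> (branch_space z t) (branch_space z s) \<longrightarrow>
    iso_graph K \<Gamma>' (branch_space z t') (branch_space z s) \<longrightarrow> t n = t' n \<longrightarrow>
    (\<forall>j\<in>dyadic_block n. \<exists>y y'. (z j (t n), y) \<in> \<Gamma> \<and> (z j (t n), y') \<in> \<Gamma>' \<and> norm (y - y') \<le> \<delta>) \<longrightarrow>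
    E0 t t'"
proof -
  \<comment> \<open>The norm of \<open>R\<close> is at most \<open>K * K\<close>, so tails of
    \<alpha> below this value change its block traces by at most 1/4.\<close>
  have "1 / (4 * (K * K + 1)) > 0" using assms(5) by (simp add: add_nonneg_pos)
  then obtain N where N: "\<And>m n. m \<ge> N \<Longrightarrow> norm (sum \<alpha> {m..<n}) < 1 / (4 * (K * K + 1))"
    using assms(4) unfolding summable_Cauchy by blast
  \<comment> \<open>With \<open>n \<ge> 1\<close> all later indices are at least 2, where
    \<open>tr\<close> applies.\<close>
  define n where "n = max N 1"
  have "0 \<le> M" using M[of 1 True] norm_ge_zero order_trans by blast
  \<comment> \<open>A distance \<delta> between images costs \<open>K * \<delta>\<close> when pulled
    back along \<open>\<Gamma>\<close>, and \<open>M * (K * \<delta>)\<close> after applying a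
    functional. The summand 1 keeps the denominator positive.\<close>
  define \<delta> where "\<delta> = 1 / (4 * (M * K + 1))"
  have \<delta>: "\<delta> > 0" "M * (K * \<delta>) \<le> 1 / 4"
    unfolding \<delta>_def using \<open>0 \<le> M\<close> assms(5) by (simp_all add: field_simps add_pos_nonneg)
  have "E0 t t'" if \<Gamma>: "iso_graph K \<Gamma> (branch_space z t) (branch_space z s)"
    and \<Gamma>': "iso_graph K \<Gamma>' (branch_space z t') (branch_space z s)" and tt: "t n = t' n"
    and close: "\<forall>j\<in>dyadic_block n.
      \<exists>y y'. (z j (t n), y) \<in> \<Gamma> \<and> (z j (t n), y') \<in> \<Gamma>' \<and> norm (y - y') \<le> \<delta>" for t t' s \<Gamma> \<Gamma>'
  proof (rule ccontr)
    assume "\<not> E0 t t'"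
    then obtain m where m: "m \<ge> Suc n" "t m \<noteq> t' m" unfolding E0_def by blast
    have \<Delta>: "iso_graph (K * K) (\<Gamma>' O \<Gamma>\<inverse>) (branch_space z t') (branch_space z t)"
      by (intro iso_graph_comp[OF \<Gamma>' iso_graph_converse[OF \<Gamma>]] assms(5))
    obtain R where R: "bounded_linear_on (branch_space z t') (branch_space z t) R"
      "\<And>x. x \<in> branch_space z t' \<Longrightarrow> (x, R x) \<in> \<Gamma>' O \<Gamma>\<inverse>"
      by (rule iso_graph_operator[OF \<Delta>]) blast
    define c where "c = onorm_on (branch_space z t') R"
    have "0 \<in> branch_space z t'"
      unfolding branch_space_eq_seq_branch by (intro subspace_0 subspace_seq_branch)
    moreover have "norm (R x) \<le> K * K * norm x" if "x \<in> branch_space z t'" for x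
      using iso_graph_norm(1)[OF \<Delta> R(2)[OF that]] .
    ultimately have c: "0 \<le> c" "c \<le> K * K"
      unfolding c_def using onorm_on_bounds[of "branch_space z t'" "K * K" R] assms(5) by simp_all
    have diff: "\<bar>block_trace z z' k t' R - block_trace z z' n t' R\<bar> \<le> sum \<alpha> {Suc n..<Suc k} * c"
      if "k \<ge> n" for k
      using that
    proof (induction k rule: dec_induct)
      case (step k)
      have "\<bar>block_trace z z' (Suc k) t' R - block_trace z z' (Suc k - 1) t' R\<bar> \<le> \<alpha> (Suc k) * c"
        unfolding c_def using step.hyps n_def by (intro tr[OF R(1)]) auto
      then have "\<bar>block_trace z z' (Suc k) t' R - block_trace z z' n t' R\<bar>
          \<le> \<alpha> (Suc k) * c + sum \<alpha> {Suc n..<Suc k} * c"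
        using step.IH by simp
      also have "\<dots> = sum \<alpha> {Suc n..<Suc (Suc k)} * c"
        using step.hyps by (simp add: algebra_simps)
      finally show ?case .
    qed simp
    have "sum \<alpha> {Suc n..<Suc m} * c \<le> 1 / 4"
    proof -
      have "sum \<alpha> {Suc n..<Suc m} \<le> 1 / (4 * (K * K + 1))"
        using N[of "Suc n" "Suc m"] n_def unfolding real_norm_def by linarith
      then have "sum \<alpha> {Suc n..<Suc m} * c \<le> 1 / (4 * (K * K + 1)) * (K * K)"
        using c by (intro mult_mono) (simp_all add: assms(5))
      also have "\<dots> \<le> 1 / 4"
      proof -
        have "0 < 4 * (K * K + 1)" using assms(5) by (simp add: add_nonneg_pos)
        then show ?thesis by (simp add: pos_divide_le_eq)
      qed
      finally show ?thesis .
    qed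
    moreover have "block_trace z z' m t' R = 0"
    proof (rule block_trace_eq_0[OF z])
      fix j assume "j \<in> dyadic_block m"
      then have "z j (t' m) \<in> branch_space z t'"
        using m(1) by (intro mem_branch_space) simp_all
      then show "R (z j (t' m)) \<in> branch_space z t" using R(1) unfolding bounded_linear_on_def by blast
    qed (use m n_def in auto)
    ultimately have "\<bar>block_trace z z' n t' R\<bar> \<le> 1 / 4" using diff[of m] m by simp
    moreover have "block_trace z z' n t' R \<ge> 3 / 4"
    proof -
      have "3 / 4 \<le> blinfun_apply (z' j (t' n)) (R (z j (t' n)))" if j: "j \<in> dyadic_block n" for j
      proof -
        have j1: "j \<ge> 1" using dyadic_block_ge_2[OF _ j] n_def by simp
        have "z j (t' n) \<in> branch_space z t'"
          using j by (intro mem_branch_space) (simp_all add: n_def)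
        from R(2)[OF this] obtain u where u: "(z j (t' n), u) \<in> \<Gamma>'" "(R (z j (t' n)), u) \<in> \<Gamma>" by blast
        obtain y y' where y: "(z j (t n), y) \<in> \<Gamma>" "(z j (t n), y') \<in> \<Gamma>'" "norm (y - y') \<le> \<delta>"
          using bspec[OF close j] by blast
        have "u = y'" using iso_graph_unique[OF \<Gamma>' u(1)] y(2) tt by simp
        \<comment> \<open>The graph \<open>\<Gamma>\<close> relates this difference to
          \<open>y - u\<close>, so its lower bound transfers the closeness of the images back to the
          domain.\<close>
        have "norm (z j (t n) - R (z j (t' n))) \<le> K * norm (y - u)"
          by (rule iso_graph_norm(2)[OF \<Gamma> iso_graph_diff[OF \<Gamma> y(1) u(2)]])
        also have "\<dots> \<le> K * \<delta>" using y(3) \<open>u = y'\<close> assms(5) by (intro mult_left_mono) auto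
        finally have K: "norm (z j (t n) - R (z j (t' n))) \<le> K * \<delta>" .
        have "\<bar>blinfun_apply (z' j (t' n)) (z j (t n) - R (z j (t' n)))\<bar> \<le>
            norm (z' j (t' n)) * norm (z j (t n) - R (z j (t' n)))"
          using norm_blinfun[of "z' j (t' n)" "z j (t n) - R (z j (t' n))"] by simp
        also have "\<dots> \<le> M * (K * \<delta>)" using M[OF j1] K \<open>0 \<le> M\<close> by (intro mult_mono) auto
        also have "\<dots> \<le> 1 / 4" by (rule \<delta>(2))
        finally have "\<bar>1 - blinfun_apply (z' j (t' n)) (R (z j (t' n)))\<bar> \<le> 1 / 4"
          using z[OF j1 j1, of "t' n" "t' n"] tt by (simp add: blinfun.diff_right)
        then show ?thesis by linarith
      qed
      then have "(\<Sum>j\<in>dyadic_block n. 3 / 4) \<le>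
          (\<Sum>j\<in>dyadic_block n. blinfun_apply (z' j (t' n)) (R (z j (t' n))))"
        by (rule sum_mono)
      moreover have "card (dyadic_block n) = 2 ^ n" unfolding dyadic_block_def by simp
      ultimately show ?thesis unfolding block_trace_def by (simp add: le_divide_eq)
    qed
    ultimately show False by linarith
  qed
  moreover have "n \<ge> 1" unfolding n_def by simp
  ultimately show ?thesis using \<delta>(1) by (intro exI[of _ n] exI[of _ \<delta>] conjI allI impI)
qed

section \<open>Reduction of \<open>E0\<close> to isomorphism\<close>

theorem theorem6:
  assumes "separable_space (euclidean :: 'a::banach topology)"
    and "cantorized_Enflo TYPE('a)"
  shows "ergodic TYPE('a)"
proof -
  obtain z :: "nat \<Rightarrow> bool \<Rightarrow> 'a" and z' :: "nat \<Rightarrow> bool \<Rightarrow> 'a \<Rightarrow>\<^sub>L real" and \<alpha> :: "nat \<Rightarrow> real" where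
    bd: "\<And>\<epsilon>. bounded ((\<lambda>j. z' j \<epsilon>) ` {1..})"
    and bi: "\<And>i j \<epsilon> \<tau>. i \<ge> 1 \<Longrightarrow> j \<ge> 1 \<Longrightarrow>
      blinfun_apply (z' i \<epsilon>) (z j \<tau>) = (if i = j \<and> \<epsilon> = \<tau> then 1 else 0)"
    and tr: "\<And>t s T n. bounded_linear_on (branch_space z t) (branch_space z s) T \<Longrightarrow> n \<ge> 2 \<Longrightarrow>
      \<bar>block_trace z z' n t T - block_trace z z' (n - 1) t T\<bar> \<le> \<alpha> n * onorm_on (branch_space z t) T"
    and \<alpha>: "summable \<alpha>"
    using assms(2) unfolding cantorized_Enflo_def by (elim exE conjE) metis
  have "\<exists>M. \<forall>j\<ge>1. norm (z' j \<epsilon>) \<le> M" for \<epsilon>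
    using bd[of \<epsilon>] unfolding bounded_iff by auto
  then obtain B where B: "\<And>\<epsilon> j. j \<ge> 1 \<Longrightarrow> norm (z' j \<epsilon>) \<le> B \<epsilon>" by metis
  have M: "norm (z' j \<epsilon>) \<le> max (B True) (B False)" if "j \<ge> 1" for j \<epsilon>
    using B[OF that, of \<epsilon>] by (cases \<epsilon>) auto
  define e where "e j = z (j + 2)" for j
  define X where "X = seq_branch e block_index"
  have X: "X t = branch_space z t" for t
    unfolding X_def e_def branch_space_eq_seq_branch ..
  have e: "blinfun_apply (z' (i + 2) \<epsilon>) (e j \<tau>) = (if i = j \<and> \<epsilon> = \<tau> then 1 else 0)" for i j \<epsilon> \<tau>
    unfolding e_def by (simp add: bi)
  \<comment> \<open>For each constant, lists of a suitable length record enough about one block for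
    \<open>E0_of_common_image\<close> to control every section.\<close>
  have "\<exists>L. \<forall>\<sigma>. length \<sigma> = L \<longrightarrow> meager (iso_scheme e block_index (real K) \<sigma>)" for K
  proof -
    define Q where "Q n \<delta> \<longleftrightarrow> (\<forall>t t' s \<Gamma> \<Gamma>'.
      iso_graph K \<Gamma> (branch_space z t) (branch_space z s) \<longrightarrow>
      iso_graph K \<Gamma>' (branch_space z t') (branch_space z s) \<longrightarrow> t n = t' n \<longrightarrow>
      (\<forall>j\<in>dyadic_block n. \<exists>y y'. (z j (t n), y) \<in> \<Gamma> \<and> (z j (t n), y') \<in> \<Gamma>' \<and> norm (y - y') \<le> \<delta>) \<longrightarrow>
      E0 t t')" for n \<delta>
    have "\<exists>n\<ge>1. \<exists>\<delta>>0. Q n \<delta>"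
      unfolding Q_def
      by (rule E0_of_common_image[OF M bi _ \<alpha> of_nat_0_le_iff]) (assumption | rule tr)+
    then obtain n \<delta> where n: "n \<ge> 1" "\<delta> > 0" and Q: "Q n \<delta>" by blast
    \<comment> \<open>Half of \<delta> suffices because both images are compared with one
      combination.\<close>
    obtain m where m: "1 / real (Suc m) < \<delta> / 2"
      using nat_approx_posE[of "\<delta> / 2"] n(2) by auto
    \<comment> \<open>These steps name the generators of block \<open>n\<close> at precision
      \<open>m\<close>; a list of length \<open>L\<close> constrains all of their images.\<close>
    have "finite ((\<lambda>j. prod_encode (j - 2, m)) ` dyadic_block n)" by (simp add: dyadic_block_def)
    then obtain L where "\<forall>k\<in>(\<lambda>j. prod_encode (j - 2, m)) ` dyadic_block n. k < L"
      unfolding finite_nat_set_iff_bounded by blast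
    then have L: "prod_encode (j - 2, m) < L" if "j \<in> dyadic_block n" for j using that by blast
    have "meager (iso_scheme e block_index (real K) \<sigma>)" if \<sigma>: "length \<sigma> = L" for \<sigma>
    proof (rule meager_iso_scheme)
      fix t t' s assume ts: "(t, s) \<in> iso_scheme e block_index (real K) \<sigma>"
        "(t', s) \<in> iso_scheme e block_index (real K) \<sigma>" and tt: "t n = t' n"
      obtain \<Gamma> where \<Gamma>: "iso_graph K \<Gamma> (X t) (X s)"
        "\<And>k. k < L \<Longrightarrow> approx_image e block_index \<Gamma> t s k (fst (\<sigma> ! k))"
        using ts(1) \<sigma> unfolding iso_scheme_def X_def by blast
      obtain \<Gamma>' where \<Gamma>': "iso_graph K \<Gamma>' (X t') (X s)"
        "\<And>k. k < L \<Longrightarrow> approx_image e block_index \<Gamma>' t' s k (fst (\<sigma> ! k))"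
        using ts(2) \<sigma> unfolding iso_scheme_def X_def by blast
      show "E0 t t'"
      proof (rule Q[unfolded Q_def, rule_format, OF \<Gamma>(1)[unfolded X] \<Gamma>'(1)[unfolded X] tt])
        fix j assume j: "j \<in> dyadic_block n"
        have j2: "j - 2 + 2 = j" using dyadic_block_ge_2[OF n(1) j] by simp
        then have bj: "block_index (j - 2) = n" using j mem_dyadic_block_iff[of "j - 2" n] by simp
        \<comment> \<open>One vector serves both graphs, since \<sigma> and the target sequence
          \<open>s\<close> are shared.\<close>
        define c where "c = rat_comb e block_index s (fst (\<sigma> ! prod_encode (j - 2, m)))"
        have ej: "e (j - 2) \<epsilon> = z j \<epsilon>" for \<epsilon> unfolding e_def j2 ..
        obtain y where y: "(z j (t n), y) \<in> \<Gamma>" "norm (y - c) \<le> 1 / real (Suc m)"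
          using \<Gamma>(2)[OF L[OF j]] unfolding approx_image_def by (auto simp: ej bj c_def)
        obtain y' where y': "(z j (t' n), y') \<in> \<Gamma>'" "norm (y' - c) \<le> 1 / real (Suc m)"
          using \<Gamma>'(2)[OF L[OF j]] unfolding approx_image_def by (auto simp: ej bj c_def)
        have "norm (y - y') \<le> norm (y - c) + norm (y' - c)"
          using norm_triangle_ineq4[of "y - c" "y' - c"] by simp
        then have "norm (y - y') \<le> \<delta>" using y(2) y'(2) m by linarith
        then show "\<exists>y y'. (z j (t n), y) \<in> \<Gamma> \<and> (z j (t n), y') \<in> \<Gamma>' \<and> norm (y - y') \<le> \<delta>"
          using y(1) y'(1) tt by auto
      qed
    qed simp
    then show ?thesis by blast
  qed
  then obtain L where L: "\<And>K \<sigma>. length \<sigma> = L K \<Longrightarrow> meager (iso_scheme e block_index (real K) \<sigma>)"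
    by metis
  have "meager (\<Union>K::nat. \<Union>\<sigma>\<in>{\<sigma>. length \<sigma> = L K}. iso_scheme e block_index (real K) \<sigma>)"
    by (intro meager_countable_Union) (auto intro: L)
  then have "meager {(t, s). isomorphic_subspaces (X t) (X s)}"
    unfolding X_def by (rule meager_subset[OF _ isomorphic_seq_branch_subset_scheme])
  then obtain f where f: "continuous_on UNIV f" "\<And>x y. E0 x y \<Longrightarrow> E0 (f x) (f y)"
    "\<And>x y. \<not> E0 x y \<Longrightarrow> (f x, f y) \<notin> {(t, s). isomorphic_subspaces (X t) (X s)} \<or>
       (f y, f x) \<notin> {(t, s). isomorphic_subspaces (X t) (X s)}"
    by (rule E0_embeds_avoiding_meager) blast
  have "E0 x y \<longleftrightarrow> isomorphic_subspaces (X (f x)) (X (f y))" for x y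
  proof
    assume "E0 x y"
    then show "isomorphic_subspaces (X (f x)) (X (f y))"
      unfolding X_def
      by (intro E0_imp_isomorphic[where e' = "\<lambda>i. z' (i + 2)"] e finite_block_index_less f(2))
  next
    assume "isomorphic_subspaces (X (f x)) (X (f y))"
    \<comment> \<open>The map \<open>f\<close> is only known to keep one of the two ordered pairs
      out of the relation, so both orders are supplied.\<close>
    moreover from this have "isomorphic_subspaces (X (f y)) (X (f x))"
      unfolding isomorphic_subspaces_def by blast
    ultimately show "E0 x y" using f(3)[of x y] by blast
  qed
  moreover have "(\<lambda>x. X (f x)) \<in> borel \<rightarrow>\<^sub>M restrict_space effros SB"
    unfolding X_def by (intro measurable_seq_branch f(1) seq_branch_in_SB[where e' = "\<lambda>i. z' (i + 2)"] e)
  ultimately show ?thesis unfolding ergodic_def by (intro exI[of _ "\<lambda>x. X (f x)"]) simp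
qed

end
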